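(* Let $d,k,n$ be positive integers with $k\le n$, let $0\le l'<l\le d$ be integers, let $V=[v_1,\dots,v_n]\in\mathbb{R}^{d\times n}$, and let $x\in[0,1]^n$ with $\sum_ix_i=k$ be an optimal solution of the relaxation $\min\{(E_{l'}(M(x))/E_l(M(x)))^{1/(l-l')} : \sum_ix_i=k,\ 0\le x_i\le1\}$, whose optimal value is assumed finite. Let $\mathcal{U}\in\{\mathcal{U}_k,\mathcal{U}_{\le k}\}$ and let $\mu$ be a probability measure on $\mathcal{U}$ that is $\alpha$-approximate $(l',l)$-wise independent with respect to $x$. Sample $\mathcal{S}\in\mathcal{U}$ with $\Pr[\mathcal{S}=S]\propto\mu(S)E_l(V_SV_S^\top)$, and if $|\mathcal{S}|<k$ add $k-|\mathcal{S}|$ arbitrary further indices, obtaining $\mathcal{S}'$ of size $k$. Then $$\mathbb{E}\Big[\Big(\frac{E_{l'}(V_{\mathcal{S}'}V_{\mathcal{S}'}^\top)}{E_l(V_{\mathcal{S}'}V_{\mathcal{S}'}^\top)}\Big)^{\frac1{l-l'}}\Big]\le\alpha\cdot\mathrm{OPT},$$ where $\mathrm{OPT}$ is the minimum of $\big(E_{l'}(V_SV_S^\top)/E_l(V_SV_S^\top)\big)^{1/(l-l')}$ over $S\subseteq[n]$ with $|S|=k$.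
   Context: $V_S$ is the submatrix with columns indexed by $S$; $M(x)=\sum_ix_iv_iv_i^\top$. For a PSD matrix $M$ with eigenvalues $\lambda_1,\dots,\lambda_d$, $E_j(M)=e_j(\lambda)$ is the $j$-th elementary symmetric polynomial of the eigenvalues ($E_0=1$); ratios with zero denominator are $+\infty$. $\mathcal{U}_k$ ($\mathcal{U}_{\le k}$) is the family of subsets of $[n]$ of size exactly (at most) $k$. For $L\subseteq[n]$, $x^L=\prod_{i\in L}x_i$. A probability measure $\mu$ on $\mathcal{U}$ is $\alpha$-approximate $(l',l)$-wise independent with respect to $x$ if for all $T',T\subseteq[n]$ with $|T'|=l'$, $|T|=l$: $\Pr_{\mathcal{S}\sim\mu}[T'\subseteq\mathcal{S}]\,x^T\le\alpha^{l-l'}x^{T'}\Pr_{\mathcal{S}\sim\mu}[T\subseteq\mathcal{S}]$. *)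

theory Defs
  imports
    "HOL-Probability.Probability"
    "HOL-Computational_Algebra.Fundamental_Theorem_Algebra"
    "Jordan_Normal_Form.Char_Poly"
    "Jordan_Normal_Form.DL_Submatrix"
begin

unbundle no vec_syntax
hide_const (open) Finite_Cartesian_Product.mat Finite_Cartesian_Product.vec
  Finite_Cartesian_Product.row Finite_Cartesian_Product.column
  Determinants.det Finite_Cartesian_Product.transpose

text \<open>Matrices are indexed from 0, so the index set $[n]$ is \<^term>\<open>{..<n}\<close>.\<close>

definition elem_sym :: "nat \<Rightarrow> real list \<Rightarrow> real" where
  "elem_sym j xs = (\<Sum>I | I \<subseteq> {..<length xs} \<and> card I = j. \<Prod>i\<in>I. xs ! i)"

text \<open>The real eigenvalues, repeated according to algebraic multiplicity, in increasing order.
  For a symmetric matrix of size $d$ this is a list of length $d$.\<close>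

definition eigenvalue_list :: "real mat \<Rightarrow> real list" where
  "eigenvalue_list M = sorted_list_of_multiset (proots (char_poly M))"

definition E :: "nat \<Rightarrow> real mat \<Rightarrow> real" where
  "E j M = elem_sym j (eigenvalue_list M)"

lemma E_0: "E 0 M = 1"
proof -
  have "{I. I \<subseteq> {..<m} \<and> card I = 0} = {{}}" for m :: nat
    by (auto dest: finite_subset)
  then show ?thesis
    by (simp add: E_def elem_sym_def)
qed

definition ratio_obj :: "nat \<Rightarrow> nat \<Rightarrow> real mat \<Rightarrow> ennreal" where
  "ratio_obj l' l M =
     (if E l M = 0 then \<infinity> else ennreal ((E l' M / E l M) powr (1 / (real l - real l'))))"

definition cols_gram :: "real mat \<Rightarrow> nat set \<Rightarrow> real mat" where
  "cols_gram V S = submatrix V UNIV S * transpose_mat (submatrix V UNIV S)"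

text \<open>Entrywise form of $M(x) = \sum_i x_i v_i v_i^T$, where $v_i$ is the $i$-th column of $V$.\<close>

definition weighted_gram :: "real mat \<Rightarrow> real vec \<Rightarrow> real mat" where
  "weighted_gram V x = mat (dim_row V) (dim_row V)
     (\<lambda>(a, b). \<Sum>i<dim_col V. x $ i * (col V i $ a * col V i $ b))"

definition feasible :: "nat \<Rightarrow> nat \<Rightarrow> real vec set" where
  "feasible n k =
     {x \<in> carrier_vec n. (\<Sum>i<n. x $ i) = real k \<and> (\<forall>i<n. 0 \<le> x $ i \<and> x $ i \<le> 1)}"

definition optimal_relaxation ::
  "nat \<Rightarrow> nat \<Rightarrow> nat \<Rightarrow> nat \<Rightarrow> real mat \<Rightarrow> real vec \<Rightarrow> bool" where
  "optimal_relaxation n k l' l V x \<longleftrightarrow>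
     x \<in> feasible n k \<and>
     (\<forall>y\<in>feasible n k.
        ratio_obj l' l (weighted_gram V x) \<le> ratio_obj l' l (weighted_gram V y))"

definition subsets_eq :: "nat \<Rightarrow> nat \<Rightarrow> nat set set" where
  "subsets_eq n k = {S. S \<subseteq> {..<n} \<and> card S = k}"

definition subsets_le :: "nat \<Rightarrow> nat \<Rightarrow> nat set set" where
  "subsets_le n k = {S. S \<subseteq> {..<n} \<and> card S \<le> k}"

definition approx_indep ::
  "nat \<Rightarrow> real \<Rightarrow> nat \<Rightarrow> nat \<Rightarrow> real vec \<Rightarrow> nat set pmf \<Rightarrow> bool" where
  "approx_indep n \<alpha> l' l x \<mu> \<longleftrightarrow>
     (\<forall>T' T. T' \<subseteq> {..<n} \<longrightarrow> T \<subseteq> {..<n} \<longrightarrow> card T' = l' \<longrightarrow> card T = l \<longrightarrow>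
        measure_pmf.prob \<mu> {S. T' \<subseteq> S} * (\<Prod>i\<in>T. x $ i)
          \<le> \<alpha> ^ (l - l') * (\<Prod>i\<in>T'. x $ i) * measure_pmf.prob \<mu> {S. T \<subseteq> S})"

definition OPT :: "nat \<Rightarrow> nat \<Rightarrow> nat \<Rightarrow> nat \<Rightarrow> real mat \<Rightarrow> ennreal" where
  "OPT n k l' l V = (MIN S\<in>subsets_eq n k. ratio_obj l' l (cols_gram V S))"

text \<open>\<open>\<nu>\<close> is the law on \<open>\<U>\<close> with probabilities proportional to the weights \<open>w\<close>. Such a law
  exists only if the total weight is nonzero.\<close>

definition proportional_law :: "nat set set \<Rightarrow> (nat set \<Rightarrow> real) \<Rightarrow> nat set pmf \<Rightarrow> bool" where
  "proportional_law \<U> w \<nu> \<longleftrightarrow>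
     set_pmf \<nu> \<subseteq> \<U> \<and> (\<exists>c. \<forall>S\<in>\<U>. pmf \<nu> S = c * w S)"

text \<open>A possibly randomised rule that enlarges every \<open>S \<in> \<U>\<close> to a set of size \<open>k\<close>. It leaves
  sets of size \<open>k\<close> unchanged; a deterministic rule \<open>f\<close> is \<open>\<lambda>S. return_pmf (f S)\<close>.\<close>

definition completion_rule ::
  "nat \<Rightarrow> nat \<Rightarrow> nat set set \<Rightarrow> (nat set \<Rightarrow> nat set pmf) \<Rightarrow> bool" where
  "completion_rule n k \<U> K \<longleftrightarrow>
     (\<forall>S\<in>\<U>. \<forall>S'\<in>set_pmf (K S). S \<subseteq> S' \<and> S' \<in> subsets_eq n k)"

end

theory Submission
  imports Defs
begin

text \<open>
  Each $E_j(M(x))$ is affine in every $x_i$, because $x_i$ enters through a rank-one update, and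
  homogeneous of degree $j$. Hence $E_j(M(x)) = \sum_{|T| = j} x^T E_j(V_T V_T^T)$ with nonnegative
  coefficients; this replaces the Cauchy--Binet formula. Multiplying the approximate independence
  inequality by these coefficients and summing bounds $\sum_S \mu(S) E_{l'}(V_S V_S^T)$ in terms of
  $\sum_S \mu(S) E_l(V_S V_S^T)$, and Jensen's inequality passes to the root of order $l - l'$.

  Enlarging $S$ does not increase the ratio: in an eigenbasis of $M$ with eigenvalues
  $\lambda_i$, $\det(z + M + t v v^T) = \prod_i (z + \lambda_i) + t \sum_i u_i^2 \prod_{k \ne i}
  (z + \lambda_k)$, and the claim reduces to log-concavity of the coefficients of
  $\prod_{k \ne i} (z + \lambda_k)$.
\<close>

text \<open>Diagonalization is needed because \<open>E\<close> is defined through the list of real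
  eigenvalues, while affinity in each coordinate and monotonicity are visible on determinants. The
  characteristic polynomial is taken of the negated matrix, so that its coefficients are the
  elementary symmetric polynomials of the eigenvalues without alternating signs. Ratios of the
  \<open>E j\<close> are compared in cross-multiplied form and divided out once the denominator is
  known to be positive.

  The sampling weight is chosen to cancel a denominator. With m = l - l', the mean of the m-th power
  of the objective under \<nu> is at most the quotient of the \<mu>-means of E_l' and E_l; it need
  not be equal, since sets with E_l = 0 are never sampled but still count in the numerator.
  Approximate independence bounds this quotient by \<alpha>^m times the ratio at M(x), and
  optimality of x bounds the root of that ratio by OPT, because indicator vectors of k-sets are
  feasible.\<close>

unbundle no inner_syntax

section \<open>Diagonalization of real symmetric matrices\<close>

text \<open>The fundamental theorem of algebra gives a complex eigenvalue e with a complex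
  eigenvector w. By symmetry the Hermitian form at w equals its own conjugate, and it is e times the
  squared norm of w, so e is real. The real eigenvector comes from e being a root of the real
  characteristic polynomial, not from w.\<close>

lemma sym_mat_eigenvector:
  fixes A :: "real mat"
  assumes A: "A \<in> carrier_mat n n" and sym: "transpose_mat A = A" and "0 < n"
  obtains v e where "eigenvector A v e"
proof -
  let ?A = "map_mat complex_of_real A"
  have A': "?A \<in> carrier_mat n n" using A by simp
  have "degree (char_poly ?A) = n"
    using degree_monic_char_poly[OF A'] by simp
  with \<open>0 < n\<close> have "\<not> constant (poly (char_poly ?A))"
    by (simp add: constant_degree)
  then obtain e where "poly (char_poly ?A) e = 0"
    using fundamental_theorem_of_algebra by blast
  then have root: "poly (map_poly complex_of_real (char_poly A)) e = 0"
    by (simp add: of_real_hom.char_poly_hom[OF A])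
  have "eigenvalue ?A e"
    using \<open>poly (char_poly ?A) e = 0\<close> eigenvalue_root_char_poly[OF A'] by simp
  then obtain w where w: "w \<in> carrier_vec n" "w \<noteq> 0\<^sub>v n" "?A *\<^sub>v w = e \<cdot>\<^sub>v w"
    using A unfolding eigenvalue_def eigenvector_def by auto
  define q where "q = (\<Sum>i<n. \<Sum>j<n. of_real (A $$ (i, j)) * w $ j * cnj (w $ i))"
  define r where "r = (\<Sum>i<n. (cmod (w $ i))\<^sup>2)"
  have symA: "A $$ (i, j) = A $$ (j, i)" if "i < n" "j < n" for i j
    using arg_cong[OF sym, of "\<lambda>B. B $$ (i, j)"] that A by auto
  have "cnj q = (\<Sum>i<n. \<Sum>j<n. of_real (A $$ (i, j)) * w $ i * cnj (w $ j))"
    unfolding q_def by (simp add: cnj_sum algebra_simps)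
  also have "\<dots> = (\<Sum>j<n. \<Sum>i<n. of_real (A $$ (i, j)) * w $ i * cnj (w $ j))"
    by (rule sum.swap)
  also have "\<dots> = q"
    unfolding q_def by (intro sum.cong refl) (simp add: symA)
  finally have "q \<in> \<real>" by (simp add: Reals_cnj_iff)
  have "(\<Sum>j<n. of_real (A $$ (i, j)) * w $ j) = e * w $ i" if "i < n" for i
    using arg_cong[OF w(3), of "\<lambda>u. u $ i"] that A w(1)
    by (auto simp: scalar_prod_def atLeast0LessThan)
  then have "q = (\<Sum>i<n. e * w $ i * cnj (w $ i))"
    unfolding q_def by (intro sum.cong refl) (simp add: sum_distrib_right[symmetric])
  also have "\<dots> = e * of_real r"
    unfolding r_def of_real_sum sum_distrib_left
    by (intro sum.cong refl) (simp add: complex_norm_square[symmetric] mult.assoc)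
  finally have q: "q = e * of_real r" .
  obtain i where i: "i < n" "w $ i \<noteq> 0"
    using w(1,2) by (metis carrier_vecD eq_vecI index_zero_vec(1) index_zero_vec(2))
  have "0 < r"
    unfolding r_def by (rule sum_pos2[of _ i]) (use i in auto)
  then have "e = q / of_real r" using q by simp
  then have "e \<in> \<real>" using \<open>q \<in> \<real>\<close> by (simp add: Reals_divide)
  then obtain e' where "e = of_real e'" by (auto elim: Reals_cases)
  with root have "poly (char_poly A) e' = 0"
    by simp
  then have "eigenvalue A e'" using eigenvalue_root_char_poly[OF A] by simp
  then show thesis using that unfolding eigenvalue_def by blast
qed

text \<open>If v differs from the first basis vector u, the reflection in the hyperplane orthogonal
  to w = v - u exchanges u and v, because both have length one. Column 0 is the image of u.\<close>

lemma householder: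
  fixes v :: "real vec"
  assumes v: "v \<in> carrier_vec n" and "0 < n" and unit: "v \<bullet> v = 1"
  obtains H where "H \<in> carrier_mat n n" "transpose_mat H = H" "H * H = 1\<^sub>m n" "col H 0 = v"
proof (cases "v = unit_vec n 0")
  case True
  show thesis by (rule that[of "1\<^sub>m n"]) (use True \<open>0 < n\<close> in auto)
next
  case False
  define w where "w = (\<lambda>i. v $ i - (if i = 0 then 1 else 0))"
  define s where "s = (\<Sum>i<n. w i * w i)"
  have unit': "(\<Sum>i<n. v $ i * v $ i) = 1"
    using unit v by (simp add: scalar_prod_def atLeast0LessThan)
  have "s = (\<Sum>i<n. v $ i * v $ i - (if i = 0 then 2 * v $ i - 1 else 0))"
    unfolding s_def w_def by (intro sum.cong refl) (simp add: algebra_simps)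
  also have "\<dots> = 2 - 2 * v $ 0"
    using \<open>0 < n\<close> by (simp add: sum_subtractf unit' sum.delta)
  finally have s: "s = 2 - 2 * v $ 0" .
  have "\<exists>i<n. w i \<noteq> 0"
  proof (rule ccontr)
    assume "\<not> ?thesis"
    then have "v = unit_vec n 0"
      using v \<open>0 < n\<close> by (intro eq_vecI) (auto simp: w_def)
    with False show False by blast
  qed
  then obtain i where "i < n" "w i \<noteq> 0" by blast
  then have "0 < s"
    unfolding s_def by (intro sum_pos2[of _ i]) (auto simp: zero_less_mult_iff linorder_neq_iff)
  define H where "H = mat n n (\<lambda>(i, j). (if i = j then 1 else 0) - 2 / s * w i * w j)"
  have H: "H \<in> carrier_mat n n" by (simp add: H_def)
  have "H * H = 1\<^sub>m n"
  proof (rule eq_matI)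
    fix i j assume ij: "i < dim_row (1\<^sub>m n)" "j < dim_col (1\<^sub>m n)"
    have "(H * H) $$ (i, j) = (\<Sum>k<n. ((if i = k then 1 else 0) - 2 / s * w i * w k)
        * ((if k = j then 1 else 0) - 2 / s * w k * w j))"
      using ij by (simp add: H_def scalar_prod_def atLeast0LessThan)
    also have "\<dots> = (\<Sum>k<n. (if k = i then (if i = j then 1 else 0) - 2 / s * w i * w j else 0)
        - (if k = j then 2 / s * w i * w j else 0) + (2 / s) * (2 / s) * w i * w j * (w k * w k))"
      by (intro sum.cong refl) (simp add: algebra_simps)
    also have "\<dots> = (if i = j then 1 else 0) - 2 / s * w i * w j - 2 / s * w i * w j
        + (2 / s) * (2 / s) * w i * w j * s"
      unfolding sum.distrib sum_subtractf sum_distrib_left[symmetric] s_def[symmetric]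
      using ij by (simp add: sum.delta)
    also have "\<dots> = (if i = j then 1 else 0)" using \<open>0 < s\<close> by (simp add: field_simps)
    finally show "(H * H) $$ (i, j) = 1\<^sub>m n $$ (i, j)" using ij by simp
  qed (use H in auto)
  moreover have "transpose_mat H = H"
    by (rule eq_matI) (auto simp: H_def)
  moreover have "col H 0 = v"
  proof (rule eq_vecI)
    fix i assume "i < dim_vec v"
    then have "i < n" using v by simp
    \<comment> \<open>From s = 2 - 2 v_0 = -2 w_0; hence column 0 of the reflection is u + w =
      v.\<close>
    have "2 / s * w 0 = -1" using s \<open>0 < s\<close> by (simp add: w_def field_simps)
    then have "2 / s * w i * w 0 = - w i" by (metis mult.assoc mult.commute mult_minus1)
    then show "col H 0 $ i = v $ i"
      using \<open>i < n\<close> \<open>0 < n\<close> by (simp add: H_def w_def)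
  qed (use H v in auto)
  ultimately show thesis using that H by blast
qed

text \<open>The columns of \<open>P\<close> are an orthonormal eigenbasis. The eigenvalues are an
  arbitrary function \<open>ls\<close>, so no order is imposed on them.\<close>

definition diagonalizes :: "nat \<Rightarrow> real mat \<Rightarrow> real mat \<Rightarrow> (nat \<Rightarrow> real) \<Rightarrow> bool" where
  "diagonalizes n P A ls \<longleftrightarrow> P \<in> carrier_mat n n \<and> transpose_mat P * P = 1\<^sub>m n \<and>
    transpose_mat P * A * P = mat n n (\<lambda>(i, j). if i = j then ls i else 0)"

text \<open>A Householder reflection moves a unit eigenvector to the first basis vector; the reflected
  matrix then splits off a block of size one.\<close>

theorem real_spectral:
  fixes A :: "real mat"
  assumes "A \<in> carrier_mat n n" and "transpose_mat A = A"
  shows "\<exists>P ls. diagonalizes n P A ls"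
  unfolding diagonalizes_def using assms
proof (induction n arbitrary: A)
  case 0
  then show ?case by (intro exI[of _ "1\<^sub>m 0"] exI[of _ "\<lambda>_. 0"]) auto
next
  case (Suc m)
  let ?n = "Suc m"
  note A = Suc.prems(1)
  obtain v0 e where ev: "eigenvector A v0 e"
    using sym_mat_eigenvector[OF Suc.prems] by blast
  then have v0: "v0 \<in> carrier_vec ?n" "v0 \<noteq> 0\<^sub>v ?n" "A *\<^sub>v v0 = e \<cdot>\<^sub>v v0"
    using A unfolding eigenvector_def by auto
  define s where "s = v0 \<bullet> v0"
  have s: "s > 0"
  proof -
    obtain i where i: "i < ?n" "v0 $ i \<noteq> 0"
      using v0(1,2) by (metis carrier_vecD eq_vecI index_zero_vec(1) index_zero_vec(2))
    show ?thesis unfolding s_def scalar_prod_def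
      by (rule sum_pos2[of _ i]) (use i v0(1) in \<open>auto simp: zero_less_mult_iff linorder_neq_iff\<close>)
  qed
  define v where "v = (1 / sqrt s) \<cdot>\<^sub>v v0"
  have v: "v \<in> carrier_vec ?n" using v0 by (simp add: v_def)
  have "v \<bullet> v = 1"
    using v0(1) s by (simp add: v_def s_def[symmetric] real_sqrt_mult_self field_simps flip: real_sqrt_mult)
  have Av: "A *\<^sub>v v = e \<cdot>\<^sub>v v"
    using A v0 by (simp add: v_def mult_mat_vec smult_smult_assoc mult.commute)
  obtain H where H: "H \<in> carrier_mat ?n ?n" "transpose_mat H = H" "H * H = 1\<^sub>m ?n" "col H 0 = v"
    using householder[OF v _ \<open>v \<bullet> v = 1\<close>] by blast
  define B where "B = H * A * H"
  have B: "B \<in> carrier_mat ?n ?n" using H A by (simp add: B_def)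
  have symB: "transpose_mat B = B"
    using H A Suc.prems(2) by (simp add: B_def transpose_mult[of _ ?n ?n _ ?n] assoc_mult_mat[of _ ?n ?n _ ?n _ ?n])
  have Hv: "H *\<^sub>v v = unit_vec ?n 0"
  proof -
    have "col (H * H) 0 = H *\<^sub>v v"
      using col_mult2[OF H(1) H(1), of 0] H(4) by simp
    then show ?thesis by (simp add: H(3))
  qed
  have "col B 0 = H * A *\<^sub>v v"
    using H A unfolding B_def by (subst col_mult2[of _ ?n ?n _ ?n]) auto
  also have "\<dots> = H *\<^sub>v (e \<cdot>\<^sub>v v)"
    using H A v Av by (simp add: assoc_mult_mat_vec[of _ ?n ?n _ ?n])
  also have "\<dots> = e \<cdot>\<^sub>v unit_vec ?n 0"
    using H v Hv by (simp add: mult_mat_vec)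
  finally have colB: "col B 0 = e \<cdot>\<^sub>v unit_vec ?n 0" .
  have B0: "B $$ (i, 0) = (if i = 0 then e else 0)" if "i < ?n" for i
    using arg_cong[OF colB, of "\<lambda>u. u $ i"] that B by auto
  \<comment> \<open>Symmetry carries the cleared first column over to the first row, which gives the
    block form.\<close>
  have B0': "B $$ (0, i) = (if i = 0 then e else 0)" if "i < ?n" for i
    using arg_cong[OF symB, of "\<lambda>C. C $$ (0, i)"] that B B0[OF that] by auto
  define B' where "B' = mat m m (\<lambda>(i, j). B $$ (Suc i, Suc j))"
  have B': "B' \<in> carrier_mat m m" by (simp add: B'_def)
  have "B $$ (i, j) = B $$ (j, i)" if "i < ?n" "j < ?n" for i j
    using arg_cong[OF symB, of "\<lambda>C. C $$ (i, j)"] that B by auto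
  then have "transpose_mat B' = B'"
    by (intro eq_matI) (auto simp: B'_def)
  from Suc.IH[OF B' this] obtain Q ls where Q: "Q \<in> carrier_mat m m" "transpose_mat Q * Q = 1\<^sub>m m"
    "transpose_mat Q * B' * Q = mat m m (\<lambda>(i, j). if i = j then ls i else 0)"
    by blast
  have Bblock: "B = four_block_mat (mat 1 1 (\<lambda>_. e)) (0\<^sub>m 1 m) (0\<^sub>m m 1) B'"
    by (rule eq_matI) (use B B0 B0' in \<open>auto simp: B'_def\<close>)
  define R where "R = four_block_mat (1\<^sub>m 1) (0\<^sub>m 1 m) (0\<^sub>m m 1) Q"
  have R: "R \<in> carrier_mat ?n ?n"
    using Q(1) unfolding R_def by (metis four_block_carrier_mat one_carrier_mat plus_1_eq_Suc)
  have RT: "transpose_mat R = four_block_mat (1\<^sub>m 1) (0\<^sub>m 1 m) (0\<^sub>m m 1) (transpose_mat Q)"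
    unfolding R_def using Q(1)
    by (subst transpose_four_block_mat[of _ 1 1 _ m _ m]) auto
  have RR: "transpose_mat R * R = 1\<^sub>m ?n"
    unfolding RT unfolding R_def using Q(1,2)
    by (subst mult_four_block_mat[of _ 1 1 _ m _ m _ _ 1 _ m]) (auto intro!: eq_matI)
  have RBR: "transpose_mat R * B * R =
    four_block_mat (mat 1 1 (\<lambda>_. e)) (0\<^sub>m 1 m) (0\<^sub>m m 1) (transpose_mat Q * B' * Q)"
    unfolding RT Bblock unfolding R_def using Q(1) B'
    apply (subst mult_four_block_mat[of _ 1 1 _ m _ m _ _ 1 _ m]; simp)
    apply (subst mult_four_block_mat[of _ 1 1 _ m _ m _ _ 1 _ m]; simp)
    done
  define P where "P = H * R"
  have P: "P \<in> carrier_mat ?n ?n" using H R by (simp add: P_def)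
  have PT: "transpose_mat P = transpose_mat R * H"
    using H R by (simp add: P_def transpose_mult[of _ ?n ?n _ ?n])
  have "transpose_mat P * P = transpose_mat R * (H * H) * R"
    unfolding PT unfolding P_def using H(1) R by (simp add: assoc_mult_mat[of _ ?n ?n _ ?n _ ?n])
  also have "\<dots> = 1\<^sub>m ?n"
    using R RR by (simp add: H(3))
  finally have 1: "transpose_mat P * P = 1\<^sub>m ?n" .
  have "transpose_mat P * A * P = transpose_mat R * B * R"
    unfolding PT unfolding P_def B_def using H(1) R A
    by (simp add: assoc_mult_mat[of _ ?n ?n _ ?n _ ?n])
  also have "\<dots> = mat ?n ?n (\<lambda>(i, j). if i = j then (case i of 0 \<Rightarrow> e | Suc k \<Rightarrow> ls k) else 0)"
    unfolding RBR Q(3) by (rule eq_matI) (auto split: nat.splits)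
  finally show ?case using P 1 by blast
qed

section \<open>Rank-one updates of the characteristic polynomial\<close>

text \<open>The matrix determinant lemma, by eliminating in the bordered matrix \<open>?F\<close> in
  two ways. The unit triangular \<open>?L\<close> clears the lower left block and leaves the Schur
  complement D + t u u^T; \<open>?R\<close> clears the upper right block and leaves the scalar
  \<open>?s\<close> next to D. Both have determinant 1.\<close>

lemma det_diag_plus_rank_one:
  fixes a u :: "nat \<Rightarrow> real"
  assumes a: "\<And>i. i < n \<Longrightarrow> a i \<noteq> 0"
  shows "det (mat n n (\<lambda>(i, j). (if i = j then a i else 0) + t * (u i * u j)))
    = (\<Prod>i<n. a i) * (1 + t * (\<Sum>i<n. u i * u i / a i))"
proof -
  let ?D = "mat n n (\<lambda>(i, j). if i = j then a i else 0)"
  let ?r = "mat 1 n (\<lambda>(_, j). - u j)" and ?c = "mat n 1 (\<lambda>(i, _). t * u i)"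
  let ?F = "four_block_mat (1\<^sub>m 1) ?r ?c ?D"
  let ?L = "four_block_mat (1\<^sub>m 1) (0\<^sub>m 1 n) (- ?c) (1\<^sub>m n)"
  let ?R = "four_block_mat (1\<^sub>m 1) (mat 1 n (\<lambda>(_, j). u j / a j)) (0\<^sub>m n 1) (1\<^sub>m n)"
  let ?M = "mat n n (\<lambda>(i, j). (if i = j then a i else 0) + t * (u i * u j))"
  let ?s = "1 + t * (\<Sum>i<n. u i * u i / a i)"
  have F: "?F \<in> carrier_mat (1 + n) (1 + n)" by (intro four_block_carrier_mat) auto
  have L: "?L \<in> carrier_mat (1 + n) (1 + n)" by (intro four_block_carrier_mat) auto
  have R: "?R \<in> carrier_mat (1 + n) (1 + n)" by (intro four_block_carrier_mat) auto
  have detD: "det ?D = (\<Prod>i<n. a i)"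
    by (subst det_upper_triangular[of _ n])
      (auto simp: diag_mat_def prod.list_conv_set_nth atLeast0LessThan)
  have "?L * ?F = four_block_mat (1\<^sub>m 1) ?r (0\<^sub>m n 1) ?M"
    apply (subst mult_four_block_mat[of _ 1 1 _ n _ n _ _ 1 _ n]; simp?)
    by (intro cong_four_block_mat eq_matI) (auto simp: scalar_prod_def)
  moreover have "det (four_block_mat (1\<^sub>m 1) ?r (0\<^sub>m n 1) ?M) = det ?M"
    by (subst det_four_block_mat_lower_left_zero[of _ 1 _ n]) auto
  moreover have "det ?L = 1"
    by (subst det_four_block_mat_upper_right_zero[of _ 1 _ n]) auto
  ultimately have 1: "det ?M = det ?F" using det_mult[OF L F] by simp
  have "?R * ?F = four_block_mat (mat 1 1 (\<lambda>_. ?s)) (0\<^sub>m 1 n) ?c ?D"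
    apply (subst mult_four_block_mat[of _ 1 1 _ n _ n _ _ 1 _ n]; simp?)
    using a
    by (intro cong_four_block_mat eq_matI)
      (auto simp: scalar_prod_def atLeast0LessThan sum_distrib_left algebra_simps if_distrib[of "\<lambda>x. _ * x"] sum.delta cong: if_cong)
  moreover have "det (four_block_mat (mat 1 1 (\<lambda>_. ?s)) (0\<^sub>m 1 n) ?c ?D) = ?s * det ?D"
    by (subst det_four_block_mat_upper_right_zero[of _ 1 _ n]) (auto simp: det_single)
  moreover have "det ?R = 1"
    by (subst det_four_block_mat_lower_left_zero[of _ 1 _ n]) auto
  ultimately have "det ?F = ?s * det ?D" using det_mult[OF R F] by simp
  with 1 detD show ?thesis by simp
qed

definition rank_one_update :: "real mat \<Rightarrow> real \<Rightarrow> real vec \<Rightarrow> real mat" where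
  "rank_one_update A t v =
    mat (dim_row A) (dim_row A) (\<lambda>(i, j). A $$ (i, j) + t * (v $ i * v $ j))"

text \<open>The difference has infinitely many roots. This upgrades identities proved with divisions
  that are legitimate only for large z.\<close>

lemma poly_eq_if_eventually:
  fixes p q :: "real poly"
  assumes "\<And>z. z > b \<Longrightarrow> poly p z = poly q z"
  shows "p = q"
proof (rule ccontr)
  assume "p \<noteq> q"
  then have "finite {z. poly (p - q) z = 0}" by (intro poly_roots_finite) simp
  moreover have "{b<..} \<subseteq> {z. poly (p - q) z = 0}" using assms by auto
  ultimately have "finite {b<..}" by (rule rev_finite_subset)
  then show False by (simp add: infinite_Ioi)
qed

text \<open>Conjugation by \<open>P\<close> turns A + t v v^T into a diagonal matrix plus t u u^T
  with u = P^T v. The matrix determinant lemma applies at every z that makes all z +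
  \<open>ls i\<close> nonzero, and multiplying out the quotients leaves the cofactor
  products.\<close>

lemma char_poly_rank_one_update:
  assumes A: "A \<in> carrier_mat n n" and v: "v \<in> carrier_vec n" and P: "diagonalizes n P A ls"
  shows "char_poly (- rank_one_update A t v) = (\<Prod>i<n. [:ls i, 1:]) +
    Polynomial.smult t (\<Sum>i<n. Polynomial.smult (((transpose_mat P *\<^sub>v v) $ i)\<^sup>2) (\<Prod>k\<in>{..<n} - {i}. [:ls k, 1:]))"
    (is "_ = ?rhs")
proof -
  let ?u = "\<lambda>i. (transpose_mat P *\<^sub>v v) $ i"
  let ?C = "rank_one_update A t v"
  have Pc: "P \<in> carrier_mat n n" and PP: "transpose_mat P * P = 1\<^sub>m n"
    and PAP: "transpose_mat P * A * P = mat n n (\<lambda>(i, j). if i = j then ls i else 0)"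
    using P by (auto simp: diagonalizes_def)
  have PT: "transpose_mat P \<in> carrier_mat n n" using Pc by simp
  have PP': "P * transpose_mat P = 1\<^sub>m n"
    using mat_mult_left_right_inverse[OF PT Pc PP] .
  define W where "W = mat n n (\<lambda>(i, j). t * (v $ i * v $ j))"
  have W: "W \<in> carrier_mat n n" by (simp add: W_def)
  have C: "?C = A + W" using A by (auto simp: rank_one_update_def W_def)
  have PWP: "transpose_mat P * W * P = mat n n (\<lambda>(i, j). t * (?u i * ?u j))"
  proof (rule eq_matI)
    fix i j assume ij: "i < dim_row (mat n n (\<lambda>(i, j). t * (?u i * ?u j)))"
      "j < dim_col (mat n n (\<lambda>(i, j). t * (?u i * ?u j)))"
    have u: "?u k = (\<Sum>a<n. P $$ (a, k) * v $ a)" if "k < n" for k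
      using that Pc v by (simp add: scalar_prod_def atLeast0LessThan)
    have "(transpose_mat P * W * P) $$ (i, j)
        = (\<Sum>b<n. (\<Sum>a<n. P $$ (a, i) * (t * (v $ a * v $ b))) * P $$ (b, j))"
      using ij Pc by (simp add: W_def scalar_prod_def atLeast0LessThan)
    also have "\<dots> = (\<Sum>b<n. (t * ?u i) * (P $$ (b, j) * v $ b))"
      using ij by (intro sum.cong refl) (simp add: u sum_distrib_left sum_distrib_right algebra_simps)
    also have "\<dots> = t * (?u i * ?u j)"
      using ij unfolding sum_distrib_left[symmetric] by (simp add: u)
    finally show "(transpose_mat P * W * P) $$ (i, j) = mat n n (\<lambda>(i, j). t * (?u i * ?u j)) $$ (i, j)"
      using ij by simp
  qed (use Pc in auto)
  define N where "N = mat n n (\<lambda>(i, j). (if i = j then ls i else 0) + t * (?u i * ?u j))"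
  have N: "N \<in> carrier_mat n n" by (simp add: N_def)
  have PCP: "transpose_mat P * ?C * P = N"
  proof -
    have "transpose_mat P * ?C * P = transpose_mat P * A * P + transpose_mat P * W * P"
      unfolding C using A W Pc PT
      by (simp add: mult_add_distrib_mat[of _ n n _ n] add_mult_distrib_mat[of _ n n _ _ n])
    then show ?thesis unfolding PAP PWP N_def by (auto intro!: eq_matI)
  qed
  have Cc: "?C \<in> carrier_mat n n" using A W C by simp
  have "- ?C = P * (- N) * transpose_mat P"
  proof -
    have "P * N * transpose_mat P = (P * transpose_mat P) * ?C * (P * transpose_mat P)"
      unfolding PCP[symmetric] using Cc Pc PT by (simp add: assoc_mult_mat[of _ n n _ n _ n])
    also have "\<dots> = ?C" using Cc by (simp add: PP')
    finally show ?thesis using N Pc PT by simp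
  qed
  then have "similar_mat (- ?C) (- N)"
    using Cc N Pc PT PP PP' by (intro similar_matI[of _ _ P "transpose_mat P" n]) auto
  then have cp: "char_poly (- ?C) = char_poly (- N)" by (rule char_poly_similar)
  \<comment> \<open>A common bound on all |\<open>ls i\<close>|, so that z > b keeps every z +
    \<open>ls i\<close> positive.\<close>
  define b where "b = (\<Sum>i<n. \<bar>ls i\<bar>)"
  have "poly (char_poly (- N)) z = poly ?rhs z" if z: "z > b" for z
  proof -
    have pos: "ls i + z > 0" if "i < n" for i
    proof -
      have "\<bar>ls i\<bar> \<le> b" unfolding b_def using that by (intro member_le_sum) auto
      then show ?thesis using z by simp
    qed
    have "poly (char_poly (- N)) z = det (- char_matrix (- N) z)"
      using N by (intro char_poly_matrix[of _ n]) simp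
    also have "- char_matrix (- N) z
      = mat n n (\<lambda>(i, j). (if i = j then ls i + z else 0) + t * (?u i * ?u j))"
      by (rule eq_matI) (auto simp: char_matrix_def N_def)
    also have "det \<dots> = (\<Prod>i<n. ls i + z) * (1 + t * (\<Sum>i<n. ?u i * ?u i / (ls i + z)))"
      using pos by (intro det_diag_plus_rank_one) force
    also have "\<dots> = (\<Prod>i<n. ls i + z) + t * (\<Sum>i<n. (?u i)\<^sup>2 * ((\<Prod>i<n. ls i + z) / (ls i + z)))"
      by (simp add: algebra_simps sum_distrib_left power2_eq_square)
    also have "(\<Sum>i<n. (?u i)\<^sup>2 * ((\<Prod>i<n. ls i + z) / (ls i + z)))
        = (\<Sum>i<n. (?u i)\<^sup>2 * (\<Prod>k\<in>{..<n} - {i}. ls k + z))"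
    proof (intro sum.cong refl)
      fix i assume "i \<in> {..<n}"
      then have "(\<Prod>i<n. ls i + z) = (ls i + z) * (\<Prod>k\<in>{..<n} - {i}. ls k + z)"
        by (intro prod.remove) auto
      moreover have "ls i + z \<noteq> 0" using pos[of i] \<open>i \<in> {..<n}\<close> by auto
      ultimately show "(?u i)\<^sup>2 * ((\<Prod>i<n. ls i + z) / (ls i + z))
          = (?u i)\<^sup>2 * (\<Prod>k\<in>{..<n} - {i}. ls k + z)" by simp
    qed
    finally show ?thesis by (simp add: poly_prod poly_sum)
  qed
  then show ?thesis unfolding cp by (rule poly_eq_if_eventually)
qed

text \<open>The rank-one formula with t = 0 already contains the plain determinant.\<close>

lemma char_poly_uminus_diagonalizes:
  assumes A: "A \<in> carrier_mat n n" and P: "diagonalizes n P A ls"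
  shows "char_poly (- A) = (\<Prod>i<n. [:ls i, 1:])"
proof -
  have "rank_one_update A 0 (0\<^sub>v n) = A" using A by (auto simp: rank_one_update_def)
  then show ?thesis using char_poly_rank_one_update[OF A zero_carrier_vec P, of 0] by simp
qed

lemma diagonalizes_smult:
  assumes A: "A \<in> carrier_mat n n" and P: "diagonalizes n P A ls"
  shows "diagonalizes n P (c \<cdot>\<^sub>m A) (\<lambda>i. c * ls i)"
proof -
  have Pc: "P \<in> carrier_mat n n" using P by (simp add: diagonalizes_def)
  have "transpose_mat P * (c \<cdot>\<^sub>m A) * P = c \<cdot>\<^sub>m (transpose_mat P * A * P)"
    using A Pc by (simp add: mult_smult_distrib[of _ n n _ n] mult_smult_assoc_mat[of _ n n _ n])
  also have "\<dots> = mat n n (\<lambda>(i, j). if i = j then c * ls i else 0)"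
    using P unfolding diagonalizes_def by (auto intro!: eq_matI)
  finally show ?thesis using P by (simp add: diagonalizes_def)
qed

section \<open>Elementary symmetric polynomials of eigenvalues as coefficients\<close>

text \<open>Vieta: choosing the constant term in the factors of I and the variable elsewhere leaves
  degree \<open>card A - card I\<close>.\<close>

lemma coeff_prod_linear:
  fixes f :: "'a \<Rightarrow> real"
  assumes fin: "finite A" and j: "j \<le> card A"
  shows "coeff (\<Prod>i\<in>A. [:f i, 1:]) (card A - j) = (\<Sum>I | I \<subseteq> A \<and> card I = j. \<Prod>i\<in>I. f i)"
proof -
  have "(\<Prod>i\<in>A. [:f i, 1:]) = (\<Prod>i\<in>A. [:f i:] + [:0, 1:])" by simp
  also have "\<dots> = (\<Sum>I\<in>Pow A. (\<Prod>i\<in>I. [:f i:]) * (\<Prod>i\<in>A - I. [:0, 1:]))"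
    by (rule prod_add[OF fin])
  also have "\<dots> = (\<Sum>I\<in>Pow A. monom (\<Prod>i\<in>I. f i) (card A - card I))"
  proof (intro sum.cong refl)
    fix I assume "I \<in> Pow A"
    then have "finite I" "I \<subseteq> A" using fin by (auto dest: finite_subset)
    have "(\<Prod>i\<in>I. [:f i:]) = [:\<Prod>i\<in>I. f i:]"
      using \<open>finite I\<close> by (induction I) (auto simp: one_pCons)
    moreover have "card (A - I) = card A - card I"
      using \<open>finite I\<close> \<open>I \<subseteq> A\<close> by (rule card_Diff_subset)
    ultimately show "(\<Prod>i\<in>I. [:f i:]) * (\<Prod>i\<in>A - I. [:0, 1:]) = monom (\<Prod>i\<in>I. f i) (card A - card I)"
      by (simp add: monom_altdef)
  qed
  finally have "coeff (\<Prod>i\<in>A. [:f i, 1:]) (card A - j)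
      = (\<Sum>I\<in>Pow A. if card A - card I = card A - j then \<Prod>i\<in>I. f i else 0)"
    by (simp add: coeff_sum)
  \<comment> \<open>Subtraction is truncated, so equal differences force equal cardinalities only
    because both are at most \<open>card A\<close>.\<close>
  also have "\<dots> = (\<Sum>I\<in>Pow A. if card I = j then \<Prod>i\<in>I. f i else 0)"
  proof (intro sum.cong refl)
    fix I assume "I \<in> Pow A"
    then have "card I \<le> card A" using fin by (auto intro: card_mono)
    then show "(if card A - card I = card A - j then \<Prod>i\<in>I. f i else 0) = (if card I = j then \<Prod>i\<in>I. f i else 0)"
      using j by auto
  qed
  also have "\<dots> = (\<Sum>I\<in>{I\<in>Pow A. card I = j}. \<Prod>i\<in>I. f i)"
    using fin by (intro sum.inter_filter[symmetric]) simp
  finally show ?thesis by (simp add: Pow_def)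
qed

text \<open>The eigenvalue list and \<open>ls\<close> are the same multiset, hence give the same
  product of linear factors. This is the bridge from the definition of \<open>E\<close> to
  determinants.\<close>

lemma E_eq_coeff:
  assumes A: "A \<in> carrier_mat n n" and P: "diagonalizes n P A ls" and j: "j \<le> n"
  shows "E j A = coeff (char_poly (- A)) (n - j)"
proof -
  \<comment> \<open>The product formula concerns a negated matrix; it is applied to -A to obtain
    \<open>char_poly A\<close>, whose roots define the eigenvalue list.\<close>
  have "diagonalizes n P (- A) (\<lambda>i. - 1 * ls i)"
  proof -
    have "(-1) \<cdot>\<^sub>m A = - A" by (rule eq_matI) auto
    then show ?thesis using diagonalizes_smult[OF A P, of "-1"] by simp
  qed
  then have "char_poly (- (- A)) = (\<Prod>i<n. [:- ls i, 1:])"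
    using char_poly_uminus_diagonalizes[of "- A" n P "\<lambda>i. - 1 * ls i"] A by simp
  then have cp: "char_poly A = (\<Prod>i<n. [:- ls i, 1:])" by simp
  have "proots (\<Prod>i\<in>I. [:- ls i, 1:]) = image_mset ls (mset_set I)" if "finite I" for I
    using that
  proof (induction I)
    case (insert i I)
    have "proots ([:- ls i, 1:] * (\<Prod>i\<in>I. [:- ls i, 1:]))
        = proots [:- ls i, 1:] + proots (\<Prod>i\<in>I. [:- ls i, 1:])"
      by (rule proots_mult) (auto simp: prod_zero_iff insert.hyps)
    then show ?case using insert by simp
  qed simp
  then have roots: "proots (char_poly A) = image_mset ls (mset_set {..<n})" by (simp add: cp)
  define xs where "xs = eigenvalue_list A"
  have mset: "mset xs = image_mset ls (mset_set {..<n})"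
    by (simp add: xs_def eigenvalue_list_def roots)
  have len: "length xs = n" using arg_cong[OF mset, of size] by simp
  have "char_poly (- A) = prod_mset (image_mset (\<lambda>x. [:x, 1:]) (image_mset ls (mset_set {..<n})))"
    by (simp add: char_poly_uminus_diagonalizes[OF A P] prod_unfold_prod_mset image_mset.compositionality comp_def)
  also have "\<dots> = prod_list (map (\<lambda>x. [:x, 1:]) xs)"
    by (simp flip: mset mset_map add: prod_mset_prod_list)
  also have "\<dots> = (\<Prod>i<n. [:xs ! i, 1:])"
    by (simp add: prod.list_conv_set_nth len atLeast0LessThan)
  finally show ?thesis
    using coeff_prod_linear[of "{..<n}" j "\<lambda>i. xs ! i"] j len
    by (simp add: E_def elem_sym_def xs_def)
qed

lemma E_diagonalizes:
  assumes A: "A \<in> carrier_mat n n" and P: "diagonalizes n P A ls" and j: "j \<le> n"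
  shows "E j A = (\<Sum>I | I \<subseteq> {..<n} \<and> card I = j. \<Prod>i\<in>I. ls i)"
  using coeff_prod_linear[of "{..<n}" j ls] j
  by (simp add: E_eq_coeff[OF A P j] char_poly_uminus_diagonalizes[OF A P])

text \<open>Working with \<open>ls\<close> instead of the sorted list makes the sign of c
  irrelevant, although a negative c reverses the order.\<close>

lemma E_smult:
  assumes A: "A \<in> carrier_mat n n" "transpose_mat A = A" and j: "j \<le> n"
  shows "E j (c \<cdot>\<^sub>m A) = c ^ j * E j A"
proof -
  obtain P ls where P: "diagonalizes n P A ls" using real_spectral[OF A] by blast
  show ?thesis
    unfolding E_diagonalizes[OF A(1) P j] E_diagonalizes[OF smult_carrier_mat[OF A(1)] diagonalizes_smult[OF A(1) P] j]
    by (simp add: prod.distrib sum_distrib_left)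
qed

definition psd_mat :: "nat \<Rightarrow> real mat \<Rightarrow> bool" where
  "psd_mat n A \<longleftrightarrow> A \<in> carrier_mat n n \<and> transpose_mat A = A \<and>
    (\<forall>v\<in>carrier_vec n. 0 \<le> v \<bullet> (A *\<^sub>v v))"

text \<open>\<open>ls i\<close> is the value of the quadratic form of A at the i-th column of
  \<open>P\<close>.\<close>

lemma psd_mat_diagonalizes_nonneg:
  assumes A: "psd_mat n A" and P: "diagonalizes n P A ls" and i: "i < n"
  shows "0 \<le> ls i"
proof -
  have Ac: "A \<in> carrier_mat n n" and Pc: "P \<in> carrier_mat n n"
    using A P by (auto simp: psd_mat_def diagonalizes_def)
  have "ls i = (transpose_mat P * A * P) $$ (i, i)"
    using P i by (simp add: diagonalizes_def)
  also have "\<dots> = (transpose_mat P * (A * P)) $$ (i, i)"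
    using Ac Pc by (simp add: assoc_mult_mat[of _ n n _ n _ n])
  also have "\<dots> = col P i \<bullet> (A *\<^sub>v col P i)"
    using Ac Pc i col_mult2[OF Ac Pc i] by simp
  also have "\<dots> \<ge> 0" using A Pc i by (auto simp: psd_mat_def)
  finally show ?thesis .
qed

lemma E_nonneg:
  assumes A: "psd_mat n A" and j: "j \<le> n"
  shows "0 \<le> E j A"
proof -
  have A': "A \<in> carrier_mat n n" "transpose_mat A = A" using A by (auto simp: psd_mat_def)
  obtain P ls where P: "diagonalizes n P A ls" using real_spectral[OF A'] by blast
  show ?thesis unfolding E_diagonalizes[OF A'(1) P j]
    using psd_mat_diagonalizes_nonneg[OF A P] by (intro sum_nonneg prod_nonneg) auto
qed

section \<open>Monotonicity under rank-one updates\<close>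

lemma coeff_prod_linear_nonneg:
  fixes ls :: "'a \<Rightarrow> real"
  assumes "finite I" and "\<And>i. i \<in> I \<Longrightarrow> 0 \<le> ls i"
  shows "0 \<le> coeff (\<Prod>i\<in>I. [:ls i, 1:]) m"
  using assms
proof (induction I arbitrary: m)
  case (insert i I)
  then show ?case
    by (simp add: coeff_pCons split: nat.splits)
qed simp

text \<open>Multiplication by a further factor z + a preserves the property. It is stated for all m
  \<le> p rather than for neighbouring indices, since coefficients may vanish and the local
  inequalities could then not be chained by division.\<close>

lemma coeff_prod_linear_log_concave:
  fixes ls :: "'a \<Rightarrow> real"
  assumes "finite I" and "\<And>i. i \<in> I \<Longrightarrow> 0 \<le> ls i" and "m \<le> p"
  shows "coeff (\<Prod>i\<in>I. [:ls i, 1:]) m * coeff (\<Prod>i\<in>I. [:ls i, 1:]) (Suc p)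
    \<le> coeff (\<Prod>i\<in>I. [:ls i, 1:]) (Suc m) * coeff (\<Prod>i\<in>I. [:ls i, 1:]) p"
  using assms
proof (induction I arbitrary: m p)
  case (insert i I)
  define q where "q = coeff (\<Prod>i\<in>I. [:ls i, 1:])"
  define a where "a = ls i"
  have a: "0 \<le> a" using insert.prems by (simp add: a_def)
  have nn: "0 \<le> q k" for k
    unfolding q_def using insert by (intro coeff_prod_linear_nonneg) auto
  have lc: "q k * q (Suc r) \<le> q (Suc k) * q r" if "k \<le> r" for k r
    unfolding q_def using insert.IH insert.prems that by auto
  define q' where "q' = coeff ([:a, 1:] * (\<Prod>i\<in>I. [:ls i, 1:]))"
  have q'0: "q' 0 = a * q 0" and q'S: "q' (Suc k) = q k + a * q (Suc k)" for k
    by (simp_all add: q'_def q_def)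
  have "q' m * q' (Suc p) \<le> q' (Suc m) * q' p"
  proof (cases "m = p")
    case False
    then obtain r where p: "p = Suc r" and "m \<le> r"
      using insert.prems(2) by (cases p) auto
    show ?thesis
    proof (cases m)
      case 0
      \<comment> \<open>The boundary case: \<open>q' 0\<close> has no shifted term, as if there were
        a zero coefficient at index -1.\<close>
      have "0 \<le> q 0 * q r + a * (q 1 * q r) + a * a * (q 1 * q (Suc r) - q 0 * q (Suc (Suc r)))"
        using a nn lc[of 0 "Suc r"] by (intro add_nonneg_nonneg mult_nonneg_nonneg) auto
      then show ?thesis unfolding p 0 q'0 q'S by (simp add: algebra_simps)
    next
      case (Suc k)
      then have kr: "Suc k \<le> r" using \<open>m \<le> r\<close> by simp
      \<comment> \<open>In the part linear in a, the products of the two middle coefficients cancel;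
        the remaining pair is two index shifts apart, hence the chain of two instances.\<close>
      have "q k * q (Suc (Suc r)) \<le> q (Suc k) * q (Suc r)" using kr by (intro lc) simp
      also have "\<dots> \<le> q (Suc (Suc k)) * q r" using kr by (intro lc)
      finally have "0 \<le> q (Suc (Suc k)) * q r - q k * q (Suc (Suc r))" by simp
      then have "0 \<le> (q (Suc k) * q r - q k * q (Suc r))
          + a * (q (Suc (Suc k)) * q r - q k * q (Suc (Suc r)))
          + a * a * (q (Suc (Suc k)) * q (Suc r) - q (Suc k) * q (Suc (Suc r)))"
        using a lc[of k r] lc[of "Suc k" "Suc r"] kr
        by (intro add_nonneg_nonneg mult_nonneg_nonneg) auto
      then show ?thesis unfolding p Suc q'S by (simp add: algebra_simps)
    qed
  qed simp
  then show ?case unfolding q'_def a_def prod.insert[OF insert.hyps] .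
qed simp

text \<open>Write the full product as (z + \<open>ls i\<close>) q. The terms with
  \<open>ls i\<close> are the same on both sides and cancel, and what remains is log-concavity of
  the coefficients of q with both indices lowered by one.\<close>

lemma coeff_prod_linear_cofactor:
  fixes ls :: "'a \<Rightarrow> real"
  assumes I: "finite I" and i: "i \<in> I" and nn: "\<And>i. i \<in> I \<Longrightarrow> 0 \<le> ls i" and "m \<le> p"
  shows "coeff (\<Prod>i\<in>I. [:ls i, 1:]) m * coeff (\<Prod>k\<in>I - {i}. [:ls k, 1:]) p
    \<le> coeff (\<Prod>i\<in>I. [:ls i, 1:]) p * coeff (\<Prod>k\<in>I - {i}. [:ls k, 1:]) m"
proof (cases "m = p")
  case False
  define q where "q = (\<Prod>k\<in>I - {i}. [:ls k, 1:])"
  have prod: "(\<Prod>i\<in>I. [:ls i, 1:]) = [:ls i, 1:] * q"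
    unfolding q_def by (rule prod.remove[OF I i])
  have lc: "coeff q k * coeff q (Suc r) \<le> coeff q (Suc k) * coeff q r" if "k \<le> r" for k r
    unfolding q_def using I nn that by (intro coeff_prod_linear_log_concave) auto
  have pos: "0 \<le> coeff q k" for k
    unfolding q_def using I nn by (intro coeff_prod_linear_nonneg) auto
  obtain r where p: "p = Suc r" "m \<le> r" using False \<open>m \<le> p\<close> by (cases p) auto
  show ?thesis
  proof (cases m)
    case 0
    then show ?thesis unfolding prod q_def[symmetric] p(1) using pos
      by (simp add: algebra_simps)
  next
    case (Suc k)
    then show ?thesis unfolding prod q_def[symmetric] p(1) using lc[of k r] p(2)
      by (simp add: algebra_simps)
  qed
qed simp

lemma rank_one_update_sym:
  assumes A: "A \<in> carrier_mat n n" "transpose_mat A = A"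
  shows "rank_one_update A t v \<in> carrier_mat n n"
    and "transpose_mat (rank_one_update A t v) = rank_one_update A t v"
proof -
  show "rank_one_update A t v \<in> carrier_mat n n" using A by (simp add: rank_one_update_def)
  have "A $$ (i, j) = A $$ (j, i)" if "i < n" "j < n" for i j
    using arg_cong[OF A(2), of "\<lambda>B. B $$ (i, j)"] that A(1) by auto
  then show "transpose_mat (rank_one_update A t v) = rank_one_update A t v"
    using A by (intro eq_matI) (auto simp: rank_one_update_def)
qed

text \<open>The rank-one formula is affine in t; the slope is the increment from t = 0 to t =
  1.\<close>

lemma E_rank_one_update:
  assumes A: "A \<in> carrier_mat n n" "transpose_mat A = A" and v: "v \<in> carrier_vec n" and j: "j \<le> n"
  shows "E j (rank_one_update A t v) = E j A + t * (E j (rank_one_update A 1 v) - E j A)"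
proof -
  obtain P ls where P: "diagonalizes n P A ls" using real_spectral[OF A] by blast
  note sym = rank_one_update_sym[OF A]
  have "E j (rank_one_update A t v) = coeff (char_poly (- rank_one_update A t v)) (n - j)" for t
    using real_spectral[OF sym] E_eq_coeff[OF sym(1) _ j] by metis
  then show ?thesis
    using E_eq_coeff[OF A(1) P j] char_poly_uminus_diagonalizes[OF A(1) P]
    by (simp add: char_poly_rank_one_update[OF A(1) v P])
qed

text \<open>Cross-multiplied, the products of two unperturbed coefficients cancel. The terms in t
  are compared for each cofactor separately; since E_j sits at degree n - j, l' \<le> l becomes n -
  l \<le> n - l'.\<close>

lemma E_ratio_rank_one_update:
  assumes A: "psd_mat n A" and v: "v \<in> carrier_vec n" and l: "l' \<le> l" "l \<le> n" and t: "0 \<le> t"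
  shows "E l A * E l' (rank_one_update A t v) \<le> E l' A * E l (rank_one_update A t v)"
proof -
  have A': "A \<in> carrier_mat n n" "transpose_mat A = A" using A by (auto simp: psd_mat_def)
  obtain P ls where P: "diagonalizes n P A ls" using real_spectral[OF A'] by blast
  let ?C = "rank_one_update A t v"
  note C = rank_one_update_sym[OF A', of t v]
  obtain P' ls' where P': "diagonalizes n P' ?C ls'" using real_spectral[OF C] by blast
  define u where "u = (\<lambda>i. ((transpose_mat P *\<^sub>v v) $ i)\<^sup>2)"
  define a where "a = coeff (\<Prod>i<n. [:ls i, 1:])"
  define b where "b = (\<lambda>m. \<Sum>i<n. u i * coeff (\<Prod>k\<in>{..<n} - {i}. [:ls k, 1:]) m)"
  have EA: "E j A = a (n - j)" if "j \<le> n" for j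
    using E_eq_coeff[OF A'(1) P that] char_poly_uminus_diagonalizes[OF A'(1) P] by (simp add: a_def)
  have EC: "E j ?C = a (n - j) + t * b (n - j)" if "j \<le> n" for j
    using E_eq_coeff[OF C(1) P' that]
    by (simp add: char_poly_rank_one_update[OF A'(1) v P] a_def b_def u_def coeff_sum)
  have "a (n - l) * b (n - l') \<le> a (n - l') * b (n - l)"
    unfolding b_def sum_distrib_left
  proof (rule sum_mono)
    fix i assume i: "i \<in> {..<n}"
    have "0 \<le> u i" by (simp add: u_def)
    have "a (n - l) * coeff (\<Prod>k\<in>{..<n} - {i}. [:ls k, 1:]) (n - l')
        \<le> a (n - l') * coeff (\<Prod>k\<in>{..<n} - {i}. [:ls k, 1:]) (n - l)"
      unfolding a_def using i l psd_mat_diagonalizes_nonneg[OF A P]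
      by (intro coeff_prod_linear_cofactor) auto
    from mult_left_mono[OF this \<open>0 \<le> u i\<close>]
    show "a (n - l) * (u i * coeff (\<Prod>k\<in>{..<n} - {i}. [:ls k, 1:]) (n - l'))
        \<le> a (n - l') * (u i * coeff (\<Prod>k\<in>{..<n} - {i}. [:ls k, 1:]) (n - l))"
      by (simp add: algebra_simps)
  qed
  from mult_left_mono[OF this t] show ?thesis
    using l by (simp add: EA EC algebra_simps)
qed

section \<open>Homogeneous multiaffine functions\<close>

text \<open>Induction on the variables: f = \<open>f0\<close> + x_a \<open>f1\<close>, where both
  parts no longer depend on x_a. Affinity is required at every x, not only at those vanishing off A,
  so that \<open>f0\<close> and \<open>f1\<close> inherit it.\<close>

lemma multiaffine_expansion:
  fixes f :: "('a \<Rightarrow> real) \<Rightarrow> real"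
  assumes "finite A"
    and "\<And>x i t. i \<in> A \<Longrightarrow> f (x(i := t)) = f (x(i := 0)) + t * (f (x(i := 1)) - f (x(i := 0)))"
  shows "\<exists>c. \<forall>x. (\<forall>i. i \<notin> A \<longrightarrow> x i = 0) \<longrightarrow> f x = (\<Sum>T\<in>Pow A. (\<Prod>i\<in>T. x i) * c T)"
  using assms
proof (induction A arbitrary: f)
  case empty
  show ?case
  proof (intro exI[of _ "\<lambda>_. f (\<lambda>_. 0)"] allI impI)
    fix x :: "'a \<Rightarrow> real" assume "\<forall>i. i \<notin> {} \<longrightarrow> x i = 0"
    then have "x = (\<lambda>_. 0)" by auto
    then show "f x = (\<Sum>T\<in>Pow {}. (\<Prod>i\<in>T. x i) * f (\<lambda>_. 0))" by simp
  qed
next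
  case (insert a A f)
  define f0 where "f0 = (\<lambda>x. f (x(a := 0)))"
  define f1 where "f1 = (\<lambda>x. f (x(a := 1)) - f (x(a := 0)))"
  have tw: "(x(i := s))(a := r) = (x(a := r))(i := s)" if "i \<in> A" for x i and s r :: real
    using that insert.hyps by (intro fun_upd_twist) auto
  have aff: "f (x(i := t, a := r)) = f (x(i := 0, a := r)) +
      t * (f (x(i := 1, a := r)) - f (x(i := 0, a := r)))" if "i \<in> A" for x i t r
    unfolding tw[OF that] using that by (intro insert.prems) simp
  have "\<exists>c. \<forall>x. (\<forall>i. i \<notin> A \<longrightarrow> x i = 0) \<longrightarrow> f0 x = (\<Sum>T\<in>Pow A. (\<Prod>i\<in>T. x i) * c T)"
    by (rule insert.IH) (unfold f0_def, rule aff)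
  then obtain c0 where c0: "\<And>x. (\<forall>i. i \<notin> A \<longrightarrow> x i = 0) \<Longrightarrow> f0 x = (\<Sum>T\<in>Pow A. (\<Prod>i\<in>T. x i) * c0 T)"
    by blast
  have "\<exists>c. \<forall>x. (\<forall>i. i \<notin> A \<longrightarrow> x i = 0) \<longrightarrow> f1 x = (\<Sum>T\<in>Pow A. (\<Prod>i\<in>T. x i) * c T)"
  proof (rule insert.IH)
    fix x i t assume "i \<in> A"
    show "f1 (x(i := t)) = f1 (x(i := 0)) + t * (f1 (x(i := 1)) - f1 (x(i := 0)))"
      unfolding f1_def aff[OF \<open>i \<in> A\<close>, of x t] by (simp add: algebra_simps)
  qed
  then obtain c1 where c1: "\<And>x. (\<forall>i. i \<notin> A \<longrightarrow> x i = 0) \<Longrightarrow> f1 x = (\<Sum>T\<in>Pow A. (\<Prod>i\<in>T. x i) * c1 T)"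
    by blast
  define c where "c = (\<lambda>T. if a \<in> T then c1 (T - {a}) else c0 T)"
  show ?case
  proof (intro exI[of _ c] allI impI)
    fix x :: "'a \<Rightarrow> real" assume x: "\<forall>i. i \<notin> insert a A \<longrightarrow> x i = 0"
    let ?y = "x(a := 0)"
    have y: "\<forall>i. i \<notin> A \<longrightarrow> ?y i = 0" using x by auto
    have py: "(\<Prod>i\<in>T. ?y i) = (\<Prod>i\<in>T. x i)" if "T \<in> Pow A" for T
      using that insert.hyps by (intro prod.cong refl) auto
    have "f x = f (x(a := x a))" by simp
    also have "\<dots> = f0 ?y + x a * f1 ?y"
      unfolding f0_def f1_def fun_upd_upd by (rule insert.prems) simp
    also have "f0 ?y = (\<Sum>T\<in>Pow A. (\<Prod>i\<in>T. x i) * c T)"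
      unfolding c0[OF y]
    proof (intro sum.cong refl)
      fix T assume T: "T \<in> Pow A"
      then have "a \<notin> T" using insert.hyps by auto
      then show "(\<Prod>i\<in>T. ?y i) * c0 T = (\<Prod>i\<in>T. x i) * c T"
        unfolding py[OF T] by (simp add: c_def)
    qed
    also have "x a * f1 ?y = (\<Sum>T\<in>Pow A. (\<Prod>i\<in>insert a T. x i) * c (insert a T))"
      unfolding c1[OF y] sum_distrib_left
    proof (intro sum.cong refl)
      fix T assume T: "T \<in> Pow A"
      then have "finite T" "a \<notin> T" using insert.hyps by (auto dest: finite_subset)
      then show "x a * ((\<Prod>i\<in>T. ?y i) * c1 T) = (\<Prod>i\<in>insert a T. x i) * c (insert a T)"
        unfolding py[OF T] by (simp add: c_def)
    qed
    also have "\<dots> = (\<Sum>T\<in>insert a ` Pow A. (\<Prod>i\<in>T. x i) * c T)"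
    proof -
      have "inj_on (insert a) (Pow A)" using insert.hyps by (auto simp: inj_on_def)
      then show ?thesis by (simp add: sum.reindex)
    qed
    also have "(\<Sum>T\<in>Pow A. (\<Prod>i\<in>T. x i) * c T) + \<dots> = (\<Sum>T\<in>Pow (insert a A). (\<Prod>i\<in>T. x i) * c T)"
      unfolding Pow_insert using insert.hyps by (intro sum.union_disjoint[symmetric]) auto
    finally show "f x = (\<Sum>T\<in>Pow (insert a A). (\<Prod>i\<in>T. x i) * c T)" .
  qed
qed

text \<open>On the ray s 1_T the expansion is a polynomial in s, while homogeneity makes it a
  multiple of s^j. Comparing coefficients determines every \<open>c T\<close>.\<close>

lemma homogeneous_multiaffine_expansion:
  fixes f :: "('a \<Rightarrow> real) \<Rightarrow> real"
  assumes A: "finite A"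
    and aff: "\<And>x i t. i \<in> A \<Longrightarrow> f (x(i := t)) = f (x(i := 0)) + t * (f (x(i := 1)) - f (x(i := 0)))"
    and hom: "\<And>x s. f (\<lambda>i. s * x i) = s ^ j * f x"
    and x: "\<And>i. i \<notin> A \<Longrightarrow> x i = 0"
  shows "f x = (\<Sum>T | T \<subseteq> A \<and> card T = j. (\<Prod>i\<in>T. x i) * f (indicator T))"
proof -
  obtain c where c: "\<And>x. (\<forall>i. i \<notin> A \<longrightarrow> x i = 0) \<Longrightarrow> f x = (\<Sum>T\<in>Pow A. (\<Prod>i\<in>T. x i) * c T)"
    using multiaffine_expansion[OF A, of f] aff by blast
  have ind: "f (\<lambda>i. s * indicator T i) = (\<Sum>U\<in>Pow T. s ^ card U * c U)" if T: "T \<subseteq> A" for s T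
  proof -
    have "f (\<lambda>i. s * indicator T i) = (\<Sum>U\<in>Pow A. (\<Prod>i\<in>U. s * indicator T i) * c U)"
      using T by (intro c) (auto simp: indicator_def)
    also have "\<dots> = (\<Sum>U\<in>Pow T. (\<Prod>i\<in>U. s * indicator T i) * c U)"
    proof (intro sum.mono_neutral_right ballI)
      fix U assume U: "U \<in> Pow A - Pow T"
      then obtain i where "i \<in> U" "i \<notin> T" by auto
      moreover have "finite U" using U A by (auto dest: finite_subset)
      ultimately have "(\<Prod>i\<in>U. s * indicator T i) = 0" by (intro prod_zero) (auto intro!: bexI[of _ i])
      then show "(\<Prod>i\<in>U. s * indicator T i) * c U = 0" by simp
    qed (use A T in auto)
    also have "\<dots> = (\<Sum>U\<in>Pow T. s ^ card U * c U)"
    proof (intro sum.cong refl)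
      fix U assume "U \<in> Pow T"
      then have "(\<Prod>i\<in>U. s * indicator T i) = (\<Prod>i\<in>U. s)" by (intro prod.cong) auto
      then show "(\<Prod>i\<in>U. s * indicator T i) * c U = s ^ card U * c U" by simp
    qed
    finally show ?thesis .
  qed
  have zero: "c T = 0" if T: "T \<subseteq> A" "card T \<noteq> j" for T
  proof -
    have finT: "finite T" using A T(1) by (rule finite_subset[rotated])
    \<comment> \<open>T is its only subset of full cardinality, so the coefficient of degree
      \<open>card T\<close> isolates \<open>c T\<close>.\<close>
    let ?p = "\<Sum>U\<in>Pow T. monom (c U) (card U)"
    have "?p = monom (f (indicator T)) j"
    proof (rule poly_eq_if_eventually)
      fix s :: real
      have "poly ?p s = f (\<lambda>i. s * indicator T i)"
        by (simp add: ind[OF T(1)] poly_sum poly_monom mult.commute)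
      then show "poly ?p s = poly (monom (f (indicator T)) j) s"
        by (simp add: hom poly_monom mult.commute)
    qed
    then have "coeff ?p (card T) = 0" using T(2) by simp
    moreover have "coeff ?p (card T) = (\<Sum>U\<in>Pow T. if U = T then c U else 0)"
      unfolding coeff_sum
    proof (intro sum.cong refl)
      fix U assume "U \<in> Pow T"
      then have "card U = card T \<longleftrightarrow> U = T" using finT card_subset_eq[of T U] by auto
      then show "coeff (monom (c U) (card U)) (card T) = (if U = T then c U else 0)" by simp
    qed
    ultimately show "c T = 0" using finT by simp
  qed
  have cT: "c T = f (indicator T)" if T: "T \<subseteq> A" "card T = j" for T
  proof -
    have finT: "finite T" using A T(1) by (rule finite_subset[rotated])
    have "f (indicator T) = (\<Sum>U\<in>Pow T. c U)" using ind[OF T(1), of 1] by simp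
    \<comment> \<open>A proper subset of T has fewer than j elements, so its coefficient is already
      known to be zero.\<close>
    also have "\<dots> = (\<Sum>U\<in>Pow T. if U = T then c U else 0)"
    proof (intro sum.cong refl)
      fix U assume U: "U \<in> Pow T"
      show "c U = (if U = T then c U else 0)"
      proof (cases "U = T")
        case False
        then have "card U \<noteq> j" using finT card_subset_eq[of T U] U T(2) by auto
        moreover have "U \<subseteq> A" using U T(1) by auto
        ultimately show ?thesis using zero[of U] False by simp
      qed simp
    qed
    finally show ?thesis using finT by simp
  qed
  have "f x = (\<Sum>T\<in>Pow A. (\<Prod>i\<in>T. x i) * c T)" using x by (intro c) auto
  also have "\<dots> = (\<Sum>T | T \<subseteq> A \<and> card T = j. (\<Prod>i\<in>T. x i) * c T)"
    using A zero by (intro sum.mono_neutral_right) auto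
  also have "\<dots> = (\<Sum>T | T \<subseteq> A \<and> card T = j. (\<Prod>i\<in>T. x i) * f (indicator T))"
    by (intro sum.cong refl) (auto simp: cT)
  finally show ?thesis .
qed

section \<open>Gram matrices of column selections\<close>

lemma weighted_gram_carrier:
  "V \<in> carrier_mat d n \<Longrightarrow> weighted_gram V x \<in> carrier_mat d d"
  by (simp add: weighted_gram_def)

lemma weighted_gram_sym: "transpose_mat (weighted_gram V x) = weighted_gram V x"
  by (rule eq_matI) (auto simp: weighted_gram_def mult.commute)

lemma weighted_gram_cong:
  assumes "V \<in> carrier_mat d n" and "\<And>i. i < n \<Longrightarrow> x $ i = y $ i"
  shows "weighted_gram V x = weighted_gram V y"
  using assms by (intro eq_matI) (auto simp: weighted_gram_def)

lemma weighted_gram_psd: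
  assumes V: "V \<in> carrier_mat d n" and x: "\<And>i. i < n \<Longrightarrow> 0 \<le> x $ i"
  shows "psd_mat d (weighted_gram V x)"
  unfolding psd_mat_def
proof (intro conjI ballI weighted_gram_carrier[OF V] weighted_gram_sym)
  fix v :: "real vec" assume v: "v \<in> carrier_vec d"
  have "v \<bullet> (weighted_gram V x *\<^sub>v v)
      = (\<Sum>a<d. \<Sum>b<d. \<Sum>i<n. x $ i * ((V $$ (a, i) * v $ a) * (V $$ (b, i) * v $ b)))"
    using V v by (simp add: weighted_gram_def scalar_prod_def atLeast0LessThan
      sum_distrib_left sum_distrib_right algebra_simps)
  also have "\<dots> = (\<Sum>a<d. \<Sum>i<n. \<Sum>b<d. x $ i * ((V $$ (a, i) * v $ a) * (V $$ (b, i) * v $ b)))"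
    by (intro sum.cong refl sum.swap)
  also have "\<dots> = (\<Sum>i<n. \<Sum>a<d. \<Sum>b<d. x $ i * ((V $$ (a, i) * v $ a) * (V $$ (b, i) * v $ b)))"
    by (rule sum.swap)
  also have "\<dots> = (\<Sum>i<n. x $ i * (\<Sum>a<d. V $$ (a, i) * v $ a)\<^sup>2)"
    unfolding power2_eq_square sum_product unfolding sum_distrib_left ..
  also have "\<dots> \<ge> 0" using x by (intro sum_nonneg mult_nonneg_nonneg) auto
  finally show "0 \<le> v \<bullet> (weighted_gram V x *\<^sub>v v)" .
qed

lemma weighted_gram_fun_upd:
  assumes V: "V \<in> carrier_mat d n" and i: "i < n"
  shows "weighted_gram V (vec n (f(i := t)))
    = rank_one_update (weighted_gram V (vec n (f(i := 0)))) t (col V i)"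
proof (rule eq_matI)
  let ?R = "rank_one_update (weighted_gram V (vec n (f(i := 0)))) t (col V i)"
  fix a b assume "a < dim_row ?R" "b < dim_col ?R"
  then have ab: "a < d" "b < d" using V by (auto simp: rank_one_update_def weighted_gram_def)
  let ?c = "\<lambda>k. col V k $ a * col V k $ b"
  have "(\<Sum>k<n. (f(i := t)) k * ?c k) = (\<Sum>k<n. (f(i := 0)) k * ?c k + (if k = i then t * ?c k else 0))"
    by (intro sum.cong refl) auto
  also have "\<dots> = (\<Sum>k<n. (f(i := 0)) k * ?c k) + t * ?c i"
    using i by (simp add: sum.distrib)
  finally show "weighted_gram V (vec n (f(i := t))) $$ (a, b) = ?R $$ (a, b)"
    using V ab i by (simp add: weighted_gram_def rank_one_update_def)
qed (use V in \<open>auto simp: rank_one_update_def weighted_gram_def\<close>)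

lemma weighted_gram_scale:
  assumes V: "V \<in> carrier_mat d n"
  shows "weighted_gram V (vec n (\<lambda>i. s * f i)) = s \<cdot>\<^sub>m weighted_gram V (vec n f)"
  using V by (intro eq_matI) (auto simp: weighted_gram_def sum_distrib_left mult.assoc)

lemma bij_betw_pick:
  assumes "finite S"
  shows "bij_betw (pick S) {..<card S} S"
proof -
  have "inj_on (pick S) {..<card S}"
    by (rule strict_mono_on_imp_inj_on) (auto simp: strict_mono_on_def intro: pick_mono_le)
  moreover from this have "pick S ` {..<card S} = S"
    using assms by (intro card_subset_eq) (auto simp: card_image pick_in_set_le)
  ultimately show ?thesis by (simp add: bij_betw_def)
qed

text \<open>Column selections become integral points of the relaxation, so facts about M(x)
  specialize to V_S V_S^T.\<close>

lemma cols_gram_eq_weighted_gram: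
  assumes V: "V \<in> carrier_mat d n" and S: "S \<subseteq> {..<n}"
  shows "cols_gram V S = weighted_gram V (vec n (indicator S))"
proof (rule eq_matI)
  let ?W = "weighted_gram V (vec n (indicator S))"
  have S': "{j. j < n \<and> j \<in> S} = S" using S by auto
  have finS: "finite S" using S finite_subset by blast
  have sub: "submatrix V UNIV S = mat d (card S) (\<lambda>(i, j). V $$ (i, pick S j))"
    using V by (auto simp: submatrix_def S' pick_UNIV)
  show "dim_row (cols_gram V S) = dim_row ?W" "dim_col (cols_gram V S) = dim_col ?W"
    using V by (auto simp: cols_gram_def sub weighted_gram_def)
  fix a b assume "a < dim_row ?W" "b < dim_col ?W"
  then have ab: "a < d" "b < d" using V by (auto simp: weighted_gram_def)
  have pick: "pick S k < n" if "k < card S" for k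
    using pick_in_set_le[OF that] S by auto
  have "cols_gram V S $$ (a, b) = (\<Sum>k<card S. V $$ (a, pick S k) * V $$ (b, pick S k))"
    using ab by (simp add: cols_gram_def sub scalar_prod_def atLeast0LessThan)
  also have "\<dots> = (\<Sum>i\<in>S. V $$ (a, i) * V $$ (b, i))"
    using sum.reindex_bij_betw[OF bij_betw_pick[OF finS]] .
  also have "\<dots> = (\<Sum>i<n. if i \<in> S then V $$ (a, i) * V $$ (b, i) else 0)"
    using S by (simp add: sum.If_cases Int_absorb1)
  also have "\<dots> = (\<Sum>i<n. indicator S i * (V $$ (a, i) * V $$ (b, i)))"
    by (intro sum.cong refl) (simp add: indicator_def)
  also have "\<dots> = ?W $$ (a, b)"
    using V ab by (simp add: weighted_gram_def)
  finally show "cols_gram V S $$ (a, b) = ?W $$ (a, b)" .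
qed

lemma cols_gram_psd:
  assumes "V \<in> carrier_mat d n" and "S \<subseteq> {..<n}"
  shows "psd_mat d (cols_gram V S)"
  using weighted_gram_psd[OF assms(1), of "vec n (indicator S)"]
  by (simp add: cols_gram_eq_weighted_gram[OF assms])

lemma E_weighted_gram:
  assumes V: "V \<in> carrier_mat d n" and j: "j \<le> d"
  shows "E j (weighted_gram V x) =
    (\<Sum>T | T \<subseteq> {..<n} \<and> card T = j. (\<Prod>i\<in>T. x $ i) * E j (cols_gram V T))"
proof -
  define f where "f = (\<lambda>y. E j (weighted_gram V (vec n y)))"
  \<comment> \<open>The expansion needs a function vanishing outside the index set, whereas
    \<open>x $ i\<close> is unconstrained there.\<close>
  define y where "y = (\<lambda>i. if i < n then x $ i else 0)"
  have "f y = (\<Sum>T | T \<subseteq> {..<n} \<and> card T = j. (\<Prod>i\<in>T. y i) * f (indicator T))"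
  proof (rule homogeneous_multiaffine_expansion)
    fix z i t assume "i \<in> {..<n}"
    then have i: "i < n" by simp
    show "f (z(i := t)) = f (z(i := 0)) + t * (f (z(i := 1)) - f (z(i := 0)))"
      unfolding f_def weighted_gram_fun_upd[OF V i, of _ t] weighted_gram_fun_upd[OF V i, of _ 1]
      using V i j by (intro E_rank_one_update weighted_gram_carrier weighted_gram_sym) auto
  next
    show "f (\<lambda>i. s * z i) = s ^ j * f z" for z s
      unfolding f_def weighted_gram_scale[OF V]
      using V j by (intro E_smult weighted_gram_carrier weighted_gram_sym) auto
  qed (auto simp: y_def)
  also have "f y = E j (weighted_gram V x)"
    unfolding f_def by (rule arg_cong[OF weighted_gram_cong[OF V]]) (simp add: y_def)
  also have "(\<Sum>T | T \<subseteq> {..<n} \<and> card T = j. (\<Prod>i\<in>T. y i) * f (indicator T)) =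
      (\<Sum>T | T \<subseteq> {..<n} \<and> card T = j. (\<Prod>i\<in>T. x $ i) * E j (cols_gram V T))"
  proof (intro sum.cong refl)
    fix T assume "T \<in> {T. T \<subseteq> {..<n} \<and> card T = j}"
    then have T: "T \<subseteq> {..<n}" by simp
    then have "(\<Prod>i\<in>T. y i) = (\<Prod>i\<in>T. x $ i)" by (intro prod.cong) (auto simp: y_def)
    then show "(\<Prod>i\<in>T. y i) * f (indicator T) = (\<Prod>i\<in>T. x $ i) * E j (cols_gram V T)"
      by (simp add: f_def cols_gram_eq_weighted_gram[OF V T])
  qed
  finally show ?thesis .
qed

text \<open>At x = 1_S the monomial x^T is 1 if T \<subseteq> S and 0 otherwise.\<close>

lemma E_cols_gram:
  assumes V: "V \<in> carrier_mat d n" and j: "j \<le> d" and S: "S \<subseteq> {..<n}"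
  shows "E j (cols_gram V S) =
    (\<Sum>T | T \<subseteq> {..<n} \<and> card T = j. if T \<subseteq> S then E j (cols_gram V T) else 0)"
  unfolding cols_gram_eq_weighted_gram[OF V S] E_weighted_gram[OF V j]
proof (intro sum.cong refl)
  fix T assume "T \<in> {T. T \<subseteq> {..<n} \<and> card T = j}"
  then have T: "T \<subseteq> {..<n}" by simp
  then have "finite T" using finite_subset by blast
  have "(\<Prod>i\<in>T. vec n (indicator S) $ i) = (\<Prod>i\<in>T. indicator S i :: real)"
    using T by (intro prod.cong) auto
  also have "\<dots> = (if T \<subseteq> S then 1 else 0)"
    using \<open>finite T\<close> by (auto simp: indicator_def subset_iff intro!: prod.neutral)
  finally show "(\<Prod>i\<in>T. vec n (indicator S) $ i) * E j (cols_gram V T) =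
      (if T \<subseteq> S then E j (cols_gram V T) else 0)" by simp
qed

section \<open>Effect of enlarging the column set\<close>

lemma E_cols_gram_mono:
  assumes V: "V \<in> carrier_mat d n" and j: "j \<le> d" and S: "S \<subseteq> S'" "S' \<subseteq> {..<n}"
  shows "E j (cols_gram V S) \<le> E j (cols_gram V S')"
  using S unfolding E_cols_gram[OF V j S(2)] E_cols_gram[OF V j order_trans[OF S]]
  using E_nonneg[OF cols_gram_psd[OF V] j] by (intro sum_mono) auto

text \<open>If E_l vanishes on S the right side is infinite. Otherwise E_l stays positive on the
  larger set by monotonicity, and the cross-multiplied inequality may be divided out.\<close>

lemma ratio_obj_cols_gram_insert:
  assumes V: "V \<in> carrier_mat d n" and l: "l' < l" "l \<le> d" and i: "i < n" and S: "S \<subseteq> {..<n}"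
  shows "ratio_obj l' l (cols_gram V (insert i S)) \<le> ratio_obj l' l (cols_gram V S)"
proof (cases "E l (cols_gram V S) = 0 \<or> i \<in> S")
  case True
  then show ?thesis by (auto simp: ratio_obj_def insert_absorb)
next
  case False
  let ?A = "cols_gram V S" and ?B = "cols_gram V (insert i S)"
  have S': "insert i S \<subseteq> {..<n}" using S i by auto
  \<comment> \<open>As \<open>i\<close> is not in S, both indicators are updates of one function at
    \<open>i\<close>, by 1 and by 0.\<close>
  have "(indicator (insert i S) :: nat \<Rightarrow> real) = (indicator S)(i := 1)"
    and "(indicator S :: nat \<Rightarrow> real) = (indicator S)(i := 0)"
    using False by (auto simp: indicator_def fun_eq_iff)
  then have B: "?B = rank_one_update ?A 1 (col V i)"
    unfolding cols_gram_eq_weighted_gram[OF V S] cols_gram_eq_weighted_gram[OF V S']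
    using weighted_gram_fun_upd[OF V i, of "indicator S" 1] by metis
  have cross: "E l ?A * E l' ?B \<le> E l' ?A * E l ?B"
    unfolding B using V i l by (intro E_ratio_rank_one_update[of d] cols_gram_psd[OF V S]) auto
  have "0 < E l ?A"
    using False E_nonneg[OF cols_gram_psd[OF V S] l(2)] by simp
  moreover from this have "0 < E l ?B"
    using E_cols_gram_mono[OF V l(2) subset_insertI S'] by (rule less_le_trans)
  moreover have "0 \<le> E l' ?B" using E_nonneg[OF cols_gram_psd[OF V S']] l by simp
  ultimately show ?thesis
    using cross l(1) by (auto simp: ratio_obj_def field_simps intro!: ennreal_leI powr_mono2)
qed

lemma ratio_obj_cols_gram_antimono:
  assumes V: "V \<in> carrier_mat d n" and l: "l' < l" "l \<le> d" and S: "S \<subseteq> S'" "S' \<subseteq> {..<n}"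
  shows "ratio_obj l' l (cols_gram V S') \<le> ratio_obj l' l (cols_gram V S)"
proof -
  have "ratio_obj l' l (cols_gram V (S \<union> D)) \<le> ratio_obj l' l (cols_gram V S)"
    if "finite D" "D \<subseteq> {..<n}" for D
    using that
  proof (induction D)
    case (insert i D)
    have "ratio_obj l' l (cols_gram V (insert i (S \<union> D))) \<le> ratio_obj l' l (cols_gram V (S \<union> D))"
      using insert.prems S by (intro ratio_obj_cols_gram_insert[OF V l]) auto
    also have "\<dots> \<le> ratio_obj l' l (cols_gram V S)" using insert by simp
    finally show ?case by simp
  qed simp
  from this[of S'] S show ?thesis using finite_subset[OF S(2)] by (simp add: Un_absorb1)
qed

section \<open>Jensen's inequality and means over random column sets\<close>

lemma power_sum_le_sum_power:
  fixes w y :: "'a \<Rightarrow> real"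
  assumes "finite I" and "(\<Sum>i\<in>I. w i) = 1" and "\<And>i. i \<in> I \<Longrightarrow> 0 \<le> w i" "\<And>i. i \<in> I \<Longrightarrow> 0 \<le> y i"
  shows "(\<Sum>i\<in>I. w i * y i) ^ m \<le> (\<Sum>i\<in>I. w i * y i ^ m)"
proof -
  have "convex_on {0::real..} (\<lambda>x. x ^ m)"
    using convex_power_odd convex_on_subset[OF convex_power_even] by (cases "even m") auto
  moreover have "I \<noteq> {}" using assms(2) by auto
  ultimately show ?thesis
    using convex_on_sum[of I "{0..}" "\<lambda>x. x ^ m" w y] assms by auto
qed

lemma prob_superset:
  assumes "finite \<U>" and "set_pmf \<mu> \<subseteq> \<U>"
  shows "measure_pmf.prob \<mu> {S. T \<subseteq> S} = (\<Sum>S\<in>\<U>. if T \<subseteq> S then pmf \<mu> S else 0)"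
proof -
  have fin: "finite (set_pmf \<mu>)" using assms finite_subset by blast
  have "measure_pmf.prob \<mu> {S. T \<subseteq> S} = measure_pmf.prob \<mu> ({S. T \<subseteq> S} \<inter> set_pmf \<mu>)"
    by (simp add: measure_Int_set_pmf)
  also have "\<dots> = sum (pmf \<mu>) ({S. T \<subseteq> S} \<inter> set_pmf \<mu>)"
    using fin by (intro measure_measure_pmf_finite) simp
  also have "\<dots> = sum (pmf \<mu>) {S \<in> \<U>. T \<subseteq> S}"
    using assms by (intro sum.mono_neutral_left) (auto simp: pmf_eq_0_set_pmf)
  also have "\<dots> = (\<Sum>S\<in>\<U>. if T \<subseteq> S then pmf \<mu> S else 0)"
    using assms(1) by (rule sum.inter_filter)
  finally show ?thesis .
qed

text \<open>Exchanging the sums over S and T leaves the containment probabilities, which are what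
  approximate independence controls.\<close>

lemma expectation_E_cols_gram:
  assumes V: "V \<in> carrier_mat d n" and j: "j \<le> d"
    and U: "\<U> \<subseteq> Pow {..<n}" and \<mu>: "set_pmf \<mu> \<subseteq> \<U>"
  shows "(\<Sum>S\<in>\<U>. pmf \<mu> S * E j (cols_gram V S)) =
    (\<Sum>T | T \<subseteq> {..<n} \<and> card T = j. E j (cols_gram V T) * measure_pmf.prob \<mu> {S. T \<subseteq> S})"
proof -
  have fin: "finite \<U>" using U by (rule finite_subset) simp
  have "(\<Sum>S\<in>\<U>. pmf \<mu> S * E j (cols_gram V S)) = (\<Sum>S\<in>\<U>. \<Sum>T | T \<subseteq> {..<n} \<and> card T = j.
      E j (cols_gram V T) * (if T \<subseteq> S then pmf \<mu> S else 0))"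
  proof (intro sum.cong refl)
    fix S assume "S \<in> \<U>"
    then have S: "S \<subseteq> {..<n}" using U by auto
    show "pmf \<mu> S * E j (cols_gram V S) = (\<Sum>T | T \<subseteq> {..<n} \<and> card T = j.
      E j (cols_gram V T) * (if T \<subseteq> S then pmf \<mu> S else 0))"
      unfolding E_cols_gram[OF V j S] sum_distrib_left by (intro sum.cong refl) auto
  qed
  also have "\<dots> = (\<Sum>T | T \<subseteq> {..<n} \<and> card T = j. \<Sum>S\<in>\<U>.
      E j (cols_gram V T) * (if T \<subseteq> S then pmf \<mu> S else 0))"
    by (rule sum.swap)
  finally show ?thesis
    by (simp only: prob_superset[OF fin \<mu>] sum_distrib_left)
qed

text \<open>Both sides are double sums over pairs (T', T). The left pairs Pr[T' \<subseteq> S] with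
  x^T and the right pairs x^T' with Pr[T \<subseteq> S], so the hypothesis applies term by term
  without division.\<close>

lemma approx_indep_expectation_E:
  assumes V: "V \<in> carrier_mat d n" and l: "l' \<le> d" "l \<le> d"
    and U: "\<U> \<subseteq> Pow {..<n}" and \<mu>: "set_pmf \<mu> \<subseteq> \<U>"
    and indep: "approx_indep n \<alpha> l' l x \<mu>"
  shows "(\<Sum>S\<in>\<U>. pmf \<mu> S * E l' (cols_gram V S)) * E l (weighted_gram V x)
    \<le> \<alpha> ^ (l - l') * E l' (weighted_gram V x) * (\<Sum>S\<in>\<U>. pmf \<mu> S * E l (cols_gram V S))"
proof -
  let ?p = "\<lambda>T. measure_pmf.prob \<mu> {S. T \<subseteq> S}"
  let ?e = "\<lambda>j T. E j (cols_gram V T)"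
  let ?F = "\<lambda>j. {T. T \<subseteq> {..<n} \<and> card T = j}"
  have "(\<Sum>S\<in>\<U>. pmf \<mu> S * ?e l' S) * E l (weighted_gram V x)
      = (\<Sum>T'\<in>?F l'. \<Sum>T\<in>?F l. (?e l' T' * ?p T') * ((\<Prod>i\<in>T. x $ i) * ?e l T))"
    unfolding expectation_E_cols_gram[OF V l(1) U \<mu>] E_weighted_gram[OF V l(2)] sum_product ..
  also have "\<dots> \<le> (\<Sum>T'\<in>?F l'. \<Sum>T\<in>?F l. \<alpha> ^ (l - l') * (((\<Prod>i\<in>T'. x $ i) * ?e l' T') * (?e l T * ?p T)))"
  proof (intro sum_mono)
    fix T' T assume T: "T' \<in> ?F l'" "T \<in> ?F l"
    have "?p T' * (\<Prod>i\<in>T. x $ i) \<le> \<alpha> ^ (l - l') * (\<Prod>i\<in>T'. x $ i) * ?p T"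
      using indep T unfolding approx_indep_def by blast
    moreover have "0 \<le> ?e l' T' * ?e l T"
      using T l by (intro mult_nonneg_nonneg E_nonneg[OF cols_gram_psd[OF V]]) auto
    ultimately have "(?e l' T' * ?e l T) * (?p T' * (\<Prod>i\<in>T. x $ i))
        \<le> (?e l' T' * ?e l T) * (\<alpha> ^ (l - l') * (\<Prod>i\<in>T'. x $ i) * ?p T)"
      by (rule mult_left_mono)
    then show "(?e l' T' * ?p T') * ((\<Prod>i\<in>T. x $ i) * ?e l T)
        \<le> \<alpha> ^ (l - l') * (((\<Prod>i\<in>T'. x $ i) * ?e l' T') * (?e l T * ?p T))"
      by (simp only: mult_ac)
  qed
  also have "\<dots> = \<alpha> ^ (l - l') * E l' (weighted_gram V x) * (\<Sum>S\<in>\<U>. pmf \<mu> S * ?e l S)"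
    unfolding expectation_E_cols_gram[OF V l(2) U \<mu>] E_weighted_gram[OF V l(1)] mult.assoc sum_product
    by (simp only: sum_distrib_left)
  finally show ?thesis .
qed

text \<open>The indicator of a k-set is feasible and has the same objective value there. The bound k
  \<le> n makes the family of k-sets nonempty, so that its minimum is meaningful.\<close>

lemma relaxation_le_OPT:
  assumes V: "V \<in> carrier_mat d n" and "k \<le> n" and opt: "optimal_relaxation n k l' l V x"
  shows "ratio_obj l' l (weighted_gram V x) \<le> OPT n k l' l V"
proof -
  have fin: "finite (subsets_eq n k)"
    unfolding subsets_eq_def by (rule finite_subset[of _ "Pow {..<n}"]) auto
  have ne: "subsets_eq n k \<noteq> {}"
    using \<open>k \<le> n\<close> by (auto simp: subsets_eq_def intro!: exI[of _ "{..<k}"])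
  have "ratio_obj l' l (weighted_gram V x) \<le> ratio_obj l' l (cols_gram V S)"
    if "S \<in> subsets_eq n k" for S
  proof -
    have S: "S \<subseteq> {..<n}" "card S = k" using that by (auto simp: subsets_eq_def)
    have "(\<Sum>i<n. indicator S i :: real) = real k"
      using S by (simp add: indicator_def sum.If_cases Int_absorb1 flip: of_bool_def)
    then have "vec n (indicator S) \<in> feasible n k"
      by (auto simp: feasible_def indicator_def)
    then show ?thesis
      using opt unfolding optimal_relaxation_def cols_gram_eq_weighted_gram[OF V S(1)] by blast
  qed
  then show ?thesis unfolding OPT_def using fin ne by (intro Min.boundedI) auto
qed

theorem theoremA8:
  fixes d k n l' l :: nat and V :: "real mat" and x :: "real vec" and \<alpha> :: real
    and \<U> :: "nat set set" and \<mu> \<nu> :: "nat set pmf" and K :: "nat set \<Rightarrow> nat set pmf"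
  assumes "0 < d" and "0 < k" and "0 < n" and "k \<le> n"
    and "l' < l" and "l \<le> d"
    and "V \<in> carrier_mat d n"
    and "optimal_relaxation n k l' l V x"
    and "ratio_obj l' l (weighted_gram V x) < \<infinity>"
    and "\<U> \<in> {subsets_eq n k, subsets_le n k}"
    and "set_pmf \<mu> \<subseteq> \<U>"
    and "0 \<le> \<alpha>"
    and "approx_indep n \<alpha> l' l x \<mu>"
    and "proportional_law \<U> (\<lambda>S. pmf \<mu> S * E l (cols_gram V S)) \<nu>"
    and "completion_rule n k \<U> K"
  shows "(\<integral>\<^sup>+ S'. ratio_obj l' l (cols_gram V S') \<partial>measure_pmf (bind_pmf \<nu> K))
           \<le> ennreal \<alpha> * OPT n k l' l V"
proof -
  note V = assms(7)
  have l': "l' \<le> d" using assms(5,6) by simp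
  have U: "\<U> \<subseteq> Pow {..<n}"
    using assms(10) by (auto simp: subsets_eq_def subsets_le_def)
  have finU: "finite \<U>" using U by (rule finite_subset) simp
  let ?e = "\<lambda>j S. E j (cols_gram V S)"
  have nn: "0 \<le> ?e j S" if "j \<le> d" "S \<in> \<U>" for j S
    using that U by (intro E_nonneg[OF cols_gram_psd[OF V]]) auto
  obtain c where \<nu>U: "set_pmf \<nu> \<subseteq> \<U>" and c: "\<And>S. S \<in> \<U> \<Longrightarrow> pmf \<nu> S = c * (pmf \<mu> S * ?e l S)"
    using assms(14) unfolding proportional_law_def by blast
  define N where "N = set_pmf \<nu>"
  have finN: "finite N" using \<nu>U finU unfolding N_def by (rule finite_subset)
  have NU: "S \<in> \<U>" if "S \<in> N" for S using that \<nu>U by (auto simp: N_def)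
  \<comment> \<open>Z is the total weight. The existence of \<nu> forces c Z = 1, which rules out Z
    = 0.\<close>
  define Z where "Z = (\<Sum>S\<in>\<U>. pmf \<mu> S * ?e l S)"
  have "c * Z = (\<Sum>S\<in>\<U>. pmf \<nu> S)" unfolding Z_def sum_distrib_left by (simp add: c)
  also have "\<dots> = 1" using finU \<nu>U by (rule sum_pmf_eq_1)
  finally have cZ: "c * Z = 1" .
  have "0 \<le> Z" unfolding Z_def using nn assms(6) by (intro sum_nonneg mult_nonneg_nonneg) auto
  then have Zpos: "0 < Z" using cZ by (cases "Z = 0") auto
  then have c0: "0 < c" using cZ zero_less_mult_pos2[of c Z] by simp
  have eN: "0 < ?e l S" if "S \<in> N" for S
  proof -
    have "?e l S \<noteq> 0" using that c[OF NU[OF that]] by (auto simp: N_def set_pmf_iff)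
    then show ?thesis using nn[OF assms(6) NU[OF that]] by simp
  qed

  define m where "m = l - l'"
  have m: "0 < m" and mr: "real l - real l' = real m" using assms(5) by (auto simp: m_def)
  define r where "r = (\<lambda>S. ?e l' S / ?e l S)"
  define \<rho> where "\<rho> = (\<lambda>S. r S powr (1 / real m))"
  have r0: "0 \<le> r S" if "S \<in> N" for S
    unfolding r_def using nn[OF l' NU[OF that]] eN[OF that] by simp
  have \<rho>m: "\<rho> S ^ m = r S" if "S \<in> N" for S
    using r0[OF that] m by (cases "r S = 0") (auto simp: \<rho>_def powr_powr simp flip: powr_realpow)
  define q where "q = E l' (weighted_gram V x) / E l (weighted_gram V x)"
  have x0: "\<And>i. i < n \<Longrightarrow> 0 \<le> x $ i"
    using assms(8) by (auto simp: optimal_relaxation_def feasible_def)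
  have psdx: "psd_mat d (weighted_gram V x)" using weighted_gram_psd[OF V x0] .
  have "E l (weighted_gram V x) \<noteq> 0" using assms(9) by (auto simp: ratio_obj_def)
  then have Elx: "0 < E l (weighted_gram V x)" using E_nonneg[OF psdx assms(6)] by simp
  have q0: "0 \<le> q" unfolding q_def using E_nonneg[OF psdx l'] Elx by simp

  have sum1: "(\<Sum>S\<in>N. pmf \<nu> S) = 1" unfolding N_def using finN by (intro sum_pmf_eq_1) (auto simp: N_def)
  have "(\<Sum>S\<in>N. pmf \<nu> S * \<rho> S) ^ m \<le> (\<Sum>S\<in>N. pmf \<nu> S * \<rho> S ^ m)"
    using finN sum1 by (intro power_sum_le_sum_power) (auto simp: \<rho>_def)
  \<comment> \<open>The factor E_l in the sampling weight cancels the denominator of the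
    ratio.\<close>
  also have "\<dots> = (\<Sum>S\<in>N. c * (pmf \<mu> S * ?e l' S))"
  proof (intro sum.cong refl)
    fix S assume S: "S \<in> N"
    show "pmf \<nu> S * \<rho> S ^ m = c * (pmf \<mu> S * ?e l' S)"
      unfolding \<rho>m[OF S] c[OF NU[OF S]] r_def using eN[OF S] by simp
  qed
  \<comment> \<open>Sets outside the support may have E_l' positive while E_l = 0; they only
    increase the sum.\<close>
  also have "\<dots> \<le> (\<Sum>S\<in>\<U>. c * (pmf \<mu> S * ?e l' S))"
    using finU NU c0 nn[OF l'] by (intro sum_mono2) auto
  also have "\<dots> = (\<Sum>S\<in>\<U>. pmf \<mu> S * ?e l' S) / Z"
    using cZ Zpos by (simp add: sum_distrib_left[symmetric] field_simps)
  also have "\<dots> \<le> \<alpha> ^ m * q"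
    using approx_indep_expectation_E[OF V l' assms(6) U assms(11,13)] Zpos Elx
    unfolding Z_def[symmetric] m_def[symmetric] by (simp add: q_def field_simps)
  also have "\<dots> = (\<alpha> * q powr (1 / real m)) ^ m"
    using q0 m by (cases "q = 0") (auto simp: power_mult_distrib powr_powr simp flip: powr_realpow)
  finally have bound: "(\<Sum>S\<in>N. pmf \<nu> S * \<rho> S) \<le> \<alpha> * q powr (1 / real m)"
    using m assms(12) by (subst (asm) power_mono_iff) (auto intro!: sum_nonneg simp: \<rho>_def)

  have "(\<integral>\<^sup>+ S'. ratio_obj l' l (cols_gram V S') \<partial>measure_pmf (bind_pmf \<nu> K))
      = (\<integral>\<^sup>+ S. \<integral>\<^sup>+ S'. ratio_obj l' l (cols_gram V S') \<partial>measure_pmf (K S) \<partial>measure_pmf \<nu>)"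
    by simp
  \<comment> \<open>Every possible completion of S is a superset of S, so the bound is pointwise and
    the rule \<open>K\<close> need not be known.\<close>
  also have "\<dots> \<le> (\<integral>\<^sup>+ S. ratio_obj l' l (cols_gram V S) \<partial>measure_pmf \<nu>)"
  proof (intro nn_integral_mono_AE AE_pmfI)
    fix S assume "S \<in> set_pmf \<nu>"
    then have S: "S \<in> \<U>" using \<nu>U by auto
    have "(\<integral>\<^sup>+ S'. ratio_obj l' l (cols_gram V S') \<partial>measure_pmf (K S))
        \<le> (\<integral>\<^sup>+ S'. ratio_obj l' l (cols_gram V S) \<partial>measure_pmf (K S))"
    proof (intro nn_integral_mono_AE AE_pmfI)
      fix S' assume "S' \<in> set_pmf (K S)"
      then have "S \<subseteq> S'" "S' \<subseteq> {..<n}"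
        using assms(15) S by (auto simp: completion_rule_def subsets_eq_def)
      then show "ratio_obj l' l (cols_gram V S') \<le> ratio_obj l' l (cols_gram V S)"
        by (rule ratio_obj_cols_gram_antimono[OF V assms(5,6)])
    qed
    then show "(\<integral>\<^sup>+ S'. ratio_obj l' l (cols_gram V S') \<partial>measure_pmf (K S))
        \<le> ratio_obj l' l (cols_gram V S)" by simp
  qed
  \<comment> \<open>On the finite support \<open>N\<close> the objective is finite, which allows the
    passage to the real sum already bounded.\<close>
  also have "\<dots> = (\<Sum>S\<in>N. ratio_obj l' l (cols_gram V S) * ennreal (pmf \<nu> S))"
    unfolding N_def using finN by (intro nn_integral_measure_pmf_finite) (auto simp: N_def)
  also have "\<dots> = (\<Sum>S\<in>N. ennreal (pmf \<nu> S * \<rho> S))"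
  proof (intro sum.cong refl)
    fix S assume "S \<in> N"
    then have "ratio_obj l' l (cols_gram V S) = ennreal (\<rho> S)"
      using eN[of S] by (simp add: ratio_obj_def \<rho>_def r_def mr)
    then show "ratio_obj l' l (cols_gram V S) * ennreal (pmf \<nu> S) = ennreal (pmf \<nu> S * \<rho> S)"
      by (simp add: ennreal_mult \<rho>_def mult.commute)
  qed
  also have "\<dots> = ennreal (\<Sum>S\<in>N. pmf \<nu> S * \<rho> S)"
    by (intro sum_ennreal) (simp add: \<rho>_def)
  also have "\<dots> \<le> ennreal (\<alpha> * q powr (1 / real m))"
    using bound by (rule ennreal_leI)
  also have "\<dots> = ennreal \<alpha> * ratio_obj l' l (weighted_gram V x)"
    using assms(12) Elx by (simp add: ennreal_mult ratio_obj_def q_def mr)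
  also have "\<dots> \<le> ennreal \<alpha> * OPT n k l' l V"
    by (intro mult_left_mono relaxation_le_OPT[OF V assms(4,8)]) simp
  finally show ?thesis .
qed

end
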